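(* For a positive integer $m$, let $\mathcal{D}(m)$ be the set of squarefree integers $D\ge2$ such that there is no $\alpha\in\mathcal{O}_K^+$ with $p_K(\alpha)=m$, where $K=\mathbb{Q}(\sqrt{D})$. Then \[ \mathcal{D}(1)=\emptyset,\quad \mathcal{D}(2)=\emptyset,\quad \mathcal{D}(3)=\{5\},\quad \mathcal{D}(5)=\{2,3,5\},\quad \mathcal{D}(7)=\{2,5\},\quad \mathcal{D}(11)=\{2,3,5,6,7,13,21\}. \]
   Context: For a real quadratic field $K$, $\mathcal{O}_K$ is its ring of integers and $\mathcal{O}_K^+$ is the set of totally positive elements of $\mathcal{O}_K$ (elements $\gamma$ with $\gamma>0$ and $\gamma'>0$, where $'$ denotes Galois conjugation). A partition of $\alpha\in\mathcal{O}_K^+$ is an expression $\alpha=\alpha_1+\dots+\alpha_k$ with $k\ge1$ and all $\alpha_i\in\mathcal{O}_K^+$, the order of the summands being irrelevant; $p_K(\alpha)$ is the number of partitions of $\alpha$. *)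

theory Defs
  imports "HOL-Analysis.Analysis" "HOL-Computational_Algebra.Computational_Algebra"
begin

definition quad_field :: "int \<Rightarrow> real set" where
  "quad_field D = {a + b * sqrt (of_int D) |a b. a \<in> \<rat> \<and> b \<in> \<rat>}"

definition quad_integers :: "int \<Rightarrow> real set" where
  "quad_integers D = {x \<in> quad_field D. algebraic_int x}"

text \<open>
  Galois conjugation on the quadratic field. The description is unique exactly because the
  square root of \<open>D\<close> is irrational; see \<open>quad_conj_eq\<close> below.
\<close>
definition quad_conj :: "int \<Rightarrow> real \<Rightarrow> real" where
  "quad_conj D x = (THE y. \<exists>a\<in>\<rat>. \<exists>b\<in>\<rat>. x = a + b * sqrt (of_int D) \<and> y = a - b * sqrt (of_int D))"

definition quad_integers_pos :: "int \<Rightarrow> real set" where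
  "quad_integers_pos D = {x \<in> quad_integers D. x > 0 \<and> quad_conj D x > 0}"

definition quad_partitions :: "int \<Rightarrow> real \<Rightarrow> real multiset set" where
  "quad_partitions D \<alpha> = {M. M \<noteq> {#} \<and> set_mset M \<subseteq> quad_integers_pos D \<and> \<Sum>\<^sub># M = \<alpha>}"

text \<open>
  The set of partitions of a totally positive integer is always finite. In any case \<open>card\<close> of an
  infinite set is \<open>0\<close>, so a positive value of \<open>num_partitions\<close> is a genuine count.
\<close>
definition num_partitions :: "int \<Rightarrow> real \<Rightarrow> nat" where
  "num_partitions D \<alpha> = card (quad_partitions D \<alpha>)"

definition missing_discs :: "nat \<Rightarrow> int set" where
  "missing_discs m =
     {D. D \<ge> 2 \<and> squarefree D \<and> \<not> (\<exists>\<alpha>\<in>quad_integers_pos D. num_partitions D \<alpha> = m)}"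

lemma sqrt_squarefree_irrational:
  fixes D :: int
  assumes "D \<ge> 2" "squarefree D"
  shows "sqrt (of_int D) \<notin> \<rat>"
proof
  assume rat: "sqrt (of_int D) \<in> \<rat>"
  have "algebraic_int (sqrt (of_int D))"
    by (intro algebraic_int_sqrt) auto
  then have "sqrt (of_int D) \<in> \<int>"
    using rat by (rule rational_algebraic_int_is_int)
  then obtain n where n: "sqrt (of_int D) = of_int n"
    by (auto elim: Ints_cases)
  have "of_int D = (of_int n :: real)\<^sup>2"
    using assms n by (metis of_int_0_le_iff order_trans real_sqrt_pow2 zero_le_numeral)
  then have Dn: "D = n\<^sup>2"
    by (metis of_int_eq_iff of_int_power)
  then have "is_unit n"
    using assms(2) by (auto simp: squarefree_def)
  then have "D = 1"
    using Dn by (simp add: power2_eq_1_iff abs_if split: if_splits)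
  then show False
    using assms(1) by simp
qed

lemma quad_conj_eq:
  assumes "D \<ge> 2" "squarefree D" and ab: "a \<in> \<rat>" "b \<in> \<rat>"
  shows "quad_conj D (a + b * sqrt (of_int D)) = a - b * sqrt (of_int D)"
proof -
  have uniq: "c = a \<and> d = b"
    if cd: "c \<in> \<rat>" "d \<in> \<rat>" and eq: "a + b * sqrt (of_int D) = c + d * sqrt (of_int D)" for c d
  proof -
    have "d = b"
    proof (rule ccontr)
      assume "d \<noteq> b"
      then have "sqrt (of_int D) = (a - c) / (d - b)"
        using eq by (simp add: field_simps)
      also have "\<dots> \<in> \<rat>"
        using ab cd by auto
      finally show False
        using sqrt_squarefree_irrational assms by blast
    qed
    then show ?thesis
      using eq by simp
  qed
  show ?thesis
    unfolding quad_conj_def by (rule the_equality) (use ab uniq in blast)+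
qed

end

theory Submission
  imports Defs
begin

text \<open>
  If every irrational totally positive integer has trace greater than \<open>e\<close>, then no irrational
  summand can occur in a partition of \<open>e\<close> (it and its complement would have traces adding up to more
  than \<open>2e\<close>), so \<open>e\<close> has as many partitions as in the ordinary sense. Since the first values
  of the ordinary partition function are \<open>1, 2, 3, 5, 7, 11\<close>, this settles existence for all but finitely many \<open>D\<close>; a few remaining cases
  need an explicit element.

  For non-existence, the number of partitions is invariant under conjugation and under
  multiplication by totally positive units, and it does not decrease when a totally positive integer
  is added. An element of least trace in its orbit lies in the cone spanned by \<open>1\<close> and
  \<open>1 + \<epsilon>\<close>, where \<open>\<epsilon>\<close> is a totally positive unit. In that cone, all but finitely many elements
  exceed, by a totally positive difference, one of finitely many elements with at least 12
  partitions, and the exceptions are counted one by one.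
\<close>

subsection \<open>The ring of integers\<close>

text \<open>In lowest terms the denominator \<open>b\<close> satisfies \<open>b ^ k dvd N\<close>
  for every \<open>k\<close>. If \<open>b\<close> were at least 2, the exponent \<open>nat N\<close>
  would contradict \<open>N < 2 ^ nat N\<close>.\<close>

lemma bounded_denominators_imp_Ints:
  fixes q :: real and N :: int
  assumes "q \<in> \<rat>" "N > 0" and int: "\<And>k. of_int N * q ^ k \<in> \<int>"
  shows "q \<in> \<int>"
proof -
  from assms(1) obtain a b :: int where ab: "b > 0" "coprime a b" "q = of_int a / of_int b"
    by (auto elim: Rats_cases')
  have dvd: "b ^ k dvd N" for k
  proof -
    obtain m where "of_int N * q ^ k = of_int m"
      using int[of k] by (auto elim: Ints_cases)
    then have "of_int (N * a ^ k) = (of_int (m * b ^ k) :: real)"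
      using ab by (simp add: power_divide field_simps)
    then have "N * a ^ k = m * b ^ k"
      by (simp only: of_int_eq_iff)
    then have "b ^ k dvd N * a ^ k"
      by simp
    moreover have "coprime (b ^ k) (a ^ k)"
      using ab by (simp add: coprime_commute)
    ultimately show ?thesis
      using coprime_dvd_mult_left_iff by blast
  qed
  have "b = 1"
  proof (rule ccontr)
    assume "b \<noteq> 1"
    with ab have "(2::int) ^ nat N \<le> b ^ nat N"
      by (intro power_mono) auto
    also have "\<dots> \<le> N"
      using dvd assms(2) by (intro zdvd_imp_le) auto
    also have "N < 2 ^ nat N"
      using assms(2) of_nat_less_two_power[of "nat N", where 'a = int] by simp
    finally show False by simp
  qed
  with ab show ?thesis by simp
qed

text \<open>For s = sqrt D this is the order Z[sqrt D], of index 2 in the ring of integers when D =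
  1 mod 4. Closure under products uses only the relation \<open>s * s = of_int D\<close>.\<close>

definition int_span :: "real \<Rightarrow> real set" where
  "int_span s = {of_int u + of_int v * s |u v. True}"

lemma int_spanI: "u \<in> \<int> \<Longrightarrow> v \<in> \<int> \<Longrightarrow> u + v * s \<in> int_span s"
  unfolding int_span_def by (auto elim!: Ints_cases)

lemma Ints_int_span: "u \<in> \<int> \<Longrightarrow> u \<in> int_span s"
  using int_spanI[of u 0] by simp

lemma int_span_add: "x \<in> int_span s \<Longrightarrow> y \<in> int_span s \<Longrightarrow> x + y \<in> int_span s"
proof -
  assume "x \<in> int_span s" "y \<in> int_span s"
  then obtain u v u' v' where "x = of_int u + of_int v * s" "y = of_int u' + of_int v' * s"
    unfolding int_span_def by auto
  then have "x + y = of_int (u + u') + of_int (v + v') * s"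
    by (simp add: algebra_simps)
  then show ?thesis by (metis int_spanI Ints_of_int)
qed

lemma int_span_mult:
  assumes "s * s = of_int D" "x \<in> int_span s" "y \<in> int_span s"
  shows "x * y \<in> int_span s"
proof -
  obtain u v u' v' where "x = of_int u + of_int v * s" "y = of_int u' + of_int v' * s"
    using assms unfolding int_span_def by auto
  then have "x * y = of_int u * of_int u' + of_int v * of_int v' * (s * s)
       + (of_int u * of_int v' + of_int v * of_int u') * s"
    by (simp add: algebra_simps)
  also have "\<dots> = of_int (u * u' + v * v' * D) + of_int (u * v' + v * u') * s"
    by (simp add: assms(1))
  finally show ?thesis by (metis int_spanI Ints_of_int)
qed

lemma int_span_power: "s * s = of_int D \<Longrightarrow> x \<in> int_span s \<Longrightarrow> x ^ k \<in> int_span s"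
  by (induction k) (auto intro: int_span_mult Ints_int_span)

lemma int_span_sum: "(\<And>i. i \<in> I \<Longrightarrow> f i \<in> int_span s) \<Longrightarrow> sum f I \<in> int_span s"
  by (induction I rule: infinite_finite_induct) (auto intro: int_span_add Ints_int_span)

text \<open>If \<open>d\<close> clears the denominators of \<open>x\<close> and \<open>n\<close> is
  the degree of a monic integral polynomial vanishing at \<open>x\<close>, then \<open>d ^ n\<close>
  works for all powers: for \<open>k < n\<close> because \<open>d * x\<close> lies in the ring
  \<open>int_span s\<close>, and for larger \<open>k\<close> because the equation rewrites
  \<open>x ^ n\<close> through lower powers.\<close>

lemma algebraic_int_bounded_denominators:
  fixes x :: real
  assumes "algebraic_int x" "x = a + b * s" "a \<in> \<rat>" "b \<in> \<rat>" "s * s = of_int D"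
  obtains N :: int where "N > 0" "\<And>k. of_int N * x ^ k \<in> int_span s"
proof -
  obtain a1 a2 b1 b2 :: int where ab: "a2 > 0" "a = of_int a1 / of_int a2"
      "b2 > 0" "b = of_int b1 / of_int b2"
    using assms by (auto elim!: Rats_cases')
  define d where "d = a2 * b2"
  have d: "d > 0" using ab by (simp add: d_def)
  have "of_int d * x = of_int (a1 * b2) + of_int (b1 * a2) * s"
  proof -
    have "a * of_int a2 = of_int a1" "b * of_int b2 = of_int b1" using ab by auto
    then show ?thesis
      by (simp add: assms(2) d_def algebra_simps flip: \<open>a * of_int a2 = of_int a1\<close> \<open>b * of_int b2 = of_int b1\<close>)
  qed
  then have dx: "of_int d * x \<in> int_span s"
    by (metis int_spanI Ints_of_int)
  obtain p where p: "lead_coeff p = 1" "\<And>i. coeff p i \<in> \<int>" "poly p x = 0"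
    using assms(1) by (auto simp: algebraic_int.simps)
  define n where "n = degree p"
  have "0 = (\<Sum>i\<le>n. coeff p i * x ^ i)"
    using p by (simp add: poly_altdef n_def)
  also have "\<dots> = (\<Sum>i<n. coeff p i * x ^ i) + x ^ n"
    using p by (simp add: n_def lessThan_Suc_atMost[symmetric])
  finally have xn: "x ^ n = (\<Sum>i<n. - coeff p i * x ^ i)"
    by (simp add: sum_negf)
  have "of_int (d ^ n) * x ^ k \<in> int_span s" for k
  proof (induction k rule: less_induct)
    case (less k)
    show ?case
    proof (cases "k < n")
      case True
      then have "of_int (d ^ n) * x ^ k = of_int (d ^ (n - k)) * (of_int d * x) ^ k"
        by (simp add: power_mult_distrib flip: power_add)
      also have "\<dots> \<in> int_span s"
        by (intro int_span_mult[OF assms(5)] int_span_power[OF assms(5)] dx Ints_int_span) auto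
      finally show ?thesis .
    next
      case False
      then have "x ^ k = x ^ (k - n) * x ^ n"
        by (simp flip: power_add)
      then have "of_int (d ^ n) * x ^ k = (\<Sum>i<n. - coeff p i * (of_int (d ^ n) * x ^ (k - n + i)))"
        by (simp only: xn) (simp add: sum_distrib_left power_add mult_ac)
      also have "\<dots> \<in> int_span s"
        using assms(5) p False by (intro int_span_sum int_span_mult less Ints_int_span) auto
      finally show ?thesis .
    qed
  qed
  with d show ?thesis
    using that[of "d ^ n"] by simp
qed

context
  fixes D :: int and s :: real
  assumes D: "D \<ge> 2" "squarefree D"
  defines "s \<equiv> sqrt (of_int D)"
begin

lemma sqrt_mult_self: "s * s = of_int D"
  using D by (simp add: s_def)

text \<open>Equal elements have equal conjugates, and adding the two equations cancels the
  irrational parts.\<close>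

lemma quad_coeffs_unique:
  assumes "a \<in> \<rat>" "b \<in> \<rat>" "c \<in> \<rat>" "d \<in> \<rat>" "a + b * s = c + d * s"
  shows "a = c" "b = d"
proof -
  have "quad_conj D (a + b * s) = a - b * s" "quad_conj D (c + d * s) = c - d * s"
    unfolding s_def using D assms(1-4) by (auto intro: quad_conj_eq)
  with assms(5) show "a = c" by simp
  with assms(5) have "b * s = d * s" by simp
  then show "b = d" using D by (simp add: s_def)
qed

lemma int_span_Rats:
  assumes "x \<in> int_span s" "x \<in> \<rat>"
  shows "x \<in> \<int>"
proof -
  obtain u v where uv: "x = of_int u + of_int v * s"
    using assms unfolding int_span_def by auto
  have "of_int u = x"
    by (rule quad_coeffs_unique(1)[of _ "of_int v" _ 0]) (simp_all only: assms Rats_of_int Rats_0 uv[symmetric] mult_zero_left add_0_right)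
  then show ?thesis by (metis Ints_of_int)
qed

text \<open>The shared \<open>A\<close> and \<open>B\<close> carry integrality of coordinates from
  powers of an element to powers of its conjugate, without a multiplicativity law for
  \<open>quad_conj\<close>.\<close>

lemma quad_conj_power:
  assumes "a \<in> \<rat>" "b \<in> \<rat>"
  shows "\<exists>A\<in>\<rat>. \<exists>B\<in>\<rat>. (a + b * s) ^ k = A + B * s \<and> (a - b * s) ^ k = A - B * s"
proof (induction k)
  case 0
  show ?case by (intro bexI[of _ 1] bexI[of _ 0]) auto
next
  case (Suc k)
  then obtain A B where AB: "A \<in> \<rat>" "B \<in> \<rat>" "(a + b * s) ^ k = A + B * s" "(a - b * s) ^ k = A - B * s"
    by blast
  have "(a + b * s) ^ Suc k = (a * A + b * B * (s * s)) + (a * B + b * A) * s"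
       "(a - b * s) ^ Suc k = (a * A + b * B * (s * s)) - (a * B + b * A) * s"
    unfolding power_Suc AB(3,4) by (simp_all add: algebra_simps)
  moreover have "a * A + b * B * (s * s) \<in> \<rat>" "a * B + b * A \<in> \<rat>"
    unfolding sqrt_mult_self using AB assms by auto
  ultimately show ?case by blast
qed

text \<open>
  No use is made of the ring structure of the algebraic integers: all powers of an algebraic integer
  \<open>x\<close> lie in \<open>(1 / N) \<int>[\<surd>D]\<close> for one \<open>N\<close>, so the powers of its trace and its norm have bounded denominators, which forces both to be integers.
\<close>
lemma algebraic_int_trace_norm:
  assumes "algebraic_int (a + b * s)" "a \<in> \<rat>" "b \<in> \<rat>"
  shows "2 * a \<in> \<int>" "a * a - of_int D * b * b \<in> \<int>"
proof -
  define x x' where "x = a + b * s" and "x' = a - b * s"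
  obtain N :: int where N: "N > 0" "\<And>k. of_int N * x ^ k \<in> int_span s"
    using algebraic_int_bounded_denominators[OF assms(1) refl assms(2,3) sqrt_mult_self]
    by (metis x_def)
  have N': "of_int N * x' ^ k \<in> int_span s" for k
  proof -
    obtain A B where AB: "A \<in> \<rat>" "B \<in> \<rat>" "x ^ k = A + B * s" "x' ^ k = A - B * s"
      using quad_conj_power[OF assms(2,3), of k] by (auto simp: x_def x'_def)
    obtain u v where uv: "of_int N * x ^ k = of_int u + of_int v * s"
      using N(2)[of k] unfolding int_span_def by auto
    have "of_int N * A + of_int N * B * s = of_int u + of_int v * s"
      using uv AB by (simp add: algebra_simps)
    then have "of_int N * A = of_int u" "of_int N * B = of_int v"
      using quad_coeffs_unique[of "of_int N * A" "of_int N * B" "of_int u" "of_int v"] AB by auto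
    moreover have "of_int N * x' ^ k = of_int N * A - (of_int N * B) * s"
      unfolding AB by (simp add: algebra_simps)
    ultimately have "of_int N * x' ^ k = of_int u + of_int (- v) * s" by simp
    then show ?thesis by (metis int_spanI Ints_of_int)
  qed
  \<comment> \<open>One factor \<open>N\<close> for each conjugate: \<open>N * N\<close> clears the
    denominators of all mixed monomials, hence of every power of the trace (binomial theorem) and of
    the norm.\<close>
  have span: "of_int (N * N) * (x ^ i * x' ^ j) \<in> int_span s" for i j
    using int_span_mult[OF sqrt_mult_self N(2)[of i] N'[of j]] by (simp add: mult_ac)
  have tr: "2 * a = x + x'"
    by (simp add: x_def x'_def)
  have "x * x' = a * a - (s * s) * b * b"
    by (simp add: x_def x'_def algebra_simps)
  then have nm: "a * a - of_int D * b * b = x * x'"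
    by (simp add: sqrt_mult_self)
  show "2 * a \<in> \<int>"
  proof (rule bounded_denominators_imp_Ints)
    show "of_int (N * N) * (2 * a) ^ k \<in> \<int>" for k
    proof (rule int_span_Rats)
      have "of_int (N * N) * (2 * a) ^ k =
              (\<Sum>i\<le>k. of_nat (k choose i) * (of_int (N * N) * (x ^ i * x' ^ (k - i))))"
        unfolding tr binomial_ring sum_distrib_left by (intro sum.cong) (simp_all only: mult_ac)
      also have "\<dots> \<in> int_span s"
        by (intro int_span_sum int_span_mult[OF sqrt_mult_self] span Ints_int_span) auto
      finally show "of_int (N * N) * (2 * a) ^ k \<in> int_span s" .
    qed (use assms in auto)
  qed (use N assms in auto)
  show "a * a - of_int D * b * b \<in> \<int>"
  proof (rule bounded_denominators_imp_Ints)
    show "of_int (N * N) * (a * a - of_int D * b * b) ^ k \<in> \<int>" for k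
    proof (rule int_span_Rats)
      show "of_int (N * N) * (a * a - of_int D * b * b) ^ k \<in> int_span s"
        unfolding nm power_mult_distrib by (rule span)
    qed (use assms in auto)
  qed (use N assms in auto)
qed

text \<open>In lowest terms \<open>c / d\<close>, the square of \<open>d\<close> divides D c^2 and
  hence D, so \<open>d\<close> is a unit.\<close>

lemma squarefree_mult_square_Ints:
  fixes t :: real
  assumes "t \<in> \<rat>" "of_int D * t * t \<in> \<int>"
  shows "t \<in> \<int>"
proof -
  obtain c d :: int where cd: "d > 0" "coprime c d" "t = of_int c / of_int d"
    using assms(1) by (auto elim: Rats_cases')
  obtain m where "of_int D * t * t = of_int m"
    using assms(2) by (auto elim: Ints_cases)
  then have "of_int (D * c\<^sup>2) = (of_int (m * d\<^sup>2) :: real)"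
    using cd by (simp add: field_simps power2_eq_square)
  then have "D * c\<^sup>2 = m * d\<^sup>2"
    by (simp only: of_int_eq_iff)
  then have "d\<^sup>2 dvd D * c\<^sup>2" by simp
  moreover have "coprime (d\<^sup>2) (c\<^sup>2)"
    using cd by (simp add: coprime_commute)
  ultimately have "d\<^sup>2 dvd D"
    using coprime_dvd_mult_left_iff by blast
  then have "is_unit d"
    using D by (auto simp: squarefree_def)
  with cd show ?thesis by (simp add: zdvd1_eq)
qed

text \<open>The congruence treats all residues of D at once: for D = 1 mod 4 it says that
  \<open>x\<close> and \<open>y\<close> have the same parity, for D = 2 or 3 mod 4 that both are
  even.\<close>

lemma quad_integers_eq:
  "quad_integers D = {(of_int x + of_int y * s) / 2 |x y. 4 dvd x * x - D * y * y}"
proof (intro equalityI subsetI)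
  fix z assume "z \<in> quad_integers D"
  then obtain a b where ab: "a \<in> \<rat>" "b \<in> \<rat>" "z = a + b * s" "algebraic_int (a + b * s)"
    by (auto simp: quad_integers_def quad_field_def s_def)
  obtain x where x: "2 * a = of_int x"
    using algebraic_int_trace_norm(1)[OF ab(4,1,2)] by (auto elim: Ints_cases)
  obtain n where n: "a * a - of_int D * b * b = of_int n"
    using algebraic_int_trace_norm(2)[OF ab(4,1,2)] by (auto elim: Ints_cases)
  have xx: "(2 * a) * (2 * a) = of_int (x * x)"
    by (simp only: x of_int_mult)
  \<comment> \<open>4 D b^2 is the square of the trace minus four times the norm, hence an integer;
    squarefreeness then makes \<open>2 * b\<close> integral.\<close>
  have Dbb: "of_int D * (2 * b) * (2 * b) = of_int (x * x - 4 * n)"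
  proof -
    have "of_int D * (2 * b) * (2 * b) = (2 * a) * (2 * a) - 4 * (a * a - of_int D * b * b)"
      by (simp add: algebra_simps)
    then show ?thesis unfolding xx n by simp
  qed
  have "of_int D * (2 * b) * (2 * b) \<in> \<int>"
    unfolding Dbb by (rule Ints_of_int)
  then have "2 * b \<in> \<int>"
    by (rule squarefree_mult_square_Ints[rotated]) (use ab(2) in simp)
  then obtain y where y: "2 * b = of_int y" by (auto elim: Ints_cases)
  have "of_int (D * y * y) = (of_int (x * x - 4 * n) :: real)"
    using Dbb unfolding y by (simp only: of_int_mult)
  then have "D * y * y = x * x - 4 * n"
    by (simp only: of_int_eq_iff)
  then have "x * x - D * y * y = 4 * n"
    by simp
  then have "4 dvd x * x - D * y * y" by simp
  moreover have "z = (of_int x + of_int y * s) / 2"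
    unfolding x[symmetric] y[symmetric] by (simp add: ab(3))
  ultimately show "z \<in> {(of_int x + of_int y * s) / 2 |x y. 4 dvd x * x - D * y * y}"
    by blast
next
  fix z assume "z \<in> {(of_int x + of_int y * s) / 2 |x y. 4 dvd x * x - D * y * y}"
  then obtain x y n where z: "z = (of_int x + of_int y * s) / 2" and n: "x * x - D * y * y = 4 * n"
    by (auto elim!: dvdE)
  \<comment> \<open>Conversely, \<open>z\<close> is a root of the monic quadratic with trace
    \<open>x\<close> and norm \<open>n\<close>.\<close>
  have "4 * (z * z - of_int x * z + of_int n) =
      of_int y * of_int y * (s * s) - of_int x * of_int x + 4 * of_int n"
    unfolding z by (simp add: field_simps)
  also have "\<dots> = of_int (D * y * y - x * x + 4 * n)"
    unfolding sqrt_mult_self by simp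
  also have "\<dots> = 0"
    unfolding n[symmetric] by simp
  finally have "z * z - of_int x * z + of_int n = 0"
    by simp
  then have "poly [:of_int n, - of_int x, 1:] z = 0"
    by (simp add: algebra_simps)
  moreover have "coeff [:of_int n, - of_int x, 1:] i \<in> (\<int> :: real set)" for i
    by (auto simp: coeff_pCons split: nat.splits)
  ultimately have "algebraic_int z"
    by (intro algebraic_int.intros[of "[:of_int n, - of_int x, 1:]"]) auto
  moreover have "z = of_int x / 2 + of_int y / 2 * s"
    by (simp add: z add_divide_distrib)
  then have "z \<in> quad_field D"
    unfolding quad_field_def s_def
    by (intro CollectI exI[of _ "of_int x / 2"] exI[of _ "of_int y / 2"]) simp
  ultimately show "z \<in> quad_integers D"
    by (simp add: quad_integers_def)
qed

end

subsection \<open>Counting partitions of lattice points\<close>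

text \<open>The pair \<open>(x, y)\<close> stands for \<open>(x + y\<surd>D) / 2\<close>, so \<open>x\<close> is the trace.\<close>
definition tot_pos :: "int \<Rightarrow> (int \<times> int) set" where
  "tot_pos D = {(x, y). 0 < x \<and> D * y * y < x * x \<and> 4 dvd x * x - D * y * y}"

text \<open>Multiplying the two inequalities gives (D y y')^2 = (D y^2)(D y'^2) < (x x')^2. This
  controls the cross term in sums of elements and in products with a unit.\<close>

lemma abs_product_less:
  fixes D :: int
  assumes "0 \<le> D" "0 < x" "D * y * y < x * x" "0 < x'" "D * y' * y' < x' * x'"
  shows "\<bar>D * y * y'\<bar> < x * x'"
proof -
  have "(D * y * y')\<^sup>2 = (D * y * y) * (D * y' * y')"
    by (simp add: power2_eq_square algebra_simps)
  also have "\<dots> < (x * x) * (x' * x')"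
  proof (rule mult_strict_mono)
    show "0 \<le> D * y' * y'" using assms(1) by (simp add: mult.assoc)
  qed (use assms in auto)
  also have "\<dots> = (x * x')\<^sup>2"
    by (simp add: power2_eq_square algebra_simps)
  finally have "\<bar>D * y * y'\<bar>\<^sup>2 < (x * x')\<^sup>2" by simp
  then show ?thesis
    by (rule power_less_imp_less_base) (use assms in auto)
qed

text \<open>Modulo 2 each hypothesis says that \<open>x\<close> agrees with \<open>D * y\<close>.
  The conclusions make the coordinates of a product integral after halving.\<close>

lemma even_product_coords:
  fixes D :: int
  assumes "4 dvd x * x - D * y * y" "4 dvd x' * x' - D * y' * y'"
  shows "even (x * x' + D * y * y')" "even (x * y' + y * x')"
proof -
  have "even (x * x - D * y * y)" "even (x' * x' - D * y' * y')"
    using dvd_trans[of 2 "4 :: int"] assms by (simp_all del: even_diff even_mult_iff)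
  then show "even (x * x' + D * y * y')" "even (x * y' + y * x')"
    by auto
qed

lemma tot_pos_add:
  assumes "0 \<le> D" "a \<in> tot_pos D" "b \<in> tot_pos D"
  shows "a + b \<in> tot_pos D"
proof -
  obtain x y x' y' where ab: "a = (x, y)" "b = (x', y')" by (metis surj_pair)
  have "\<bar>D * y * y'\<bar> < x * x'"
    using assms by (intro abs_product_less) (auto simp: ab tot_pos_def)
  \<comment> \<open>Parity turns the cross term \<open>2 * (x * x' - D * y * y')\<close> of the norm
    into a multiple of 4.\<close>
  moreover have "even (x * x' - D * y * y')"
    using even_product_coords(1)[of x D y x' y'] assms by (auto simp: ab tot_pos_def)
  then obtain k where k: "x * x' - D * y * y' = 2 * k" by (elim evenE)
  then have eq: "(x + x') * (x + x') - D * (y + y') * (y + y') =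
      (x * x - D * y * y) + (x' * x' - D * y' * y') + 4 * k"
    by (simp add: algebra_simps)
  then have "4 dvd (x + x') * (x + x') - D * (y + y') * (y + y')"
    using assms by (simp add: ab tot_pos_def)
  moreover have "D * (y + y') * (y + y') < (x + x') * (x + x')"
  proof -
    have "D * (y + y') * (y + y') = D * y * y + D * y' * y' + 2 * (D * y * y')"
         "(x + x') * (x + x') = x * x + x' * x' + 2 * (x * x')"
      by (simp_all add: algebra_simps)
    moreover have "D * y * y' < x * x'" using \<open>\<bar>D * y * y'\<bar> < x * x'\<close> by linarith
    moreover have "D * y * y < x * x" "D * y' * y' < x' * x'" using assms by (auto simp: ab tot_pos_def)
    ultimately show ?thesis by linarith
  qed
  ultimately show ?thesis
    using assms by (simp add: ab tot_pos_def)
qed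

lemma sum_mset_tot_pos:
  assumes "0 \<le> D" "set_mset M \<subseteq> tot_pos D" "M \<noteq> {#}"
  shows "\<Sum>\<^sub># M \<in> tot_pos D"
  using assms(2,3)
proof (induction M)
  case (add a M)
  then show ?case
    using tot_pos_add[OF assms(1)] by (cases "M = {#}") auto
qed auto

lemma zero_notin_tot_pos: "0 \<notin> tot_pos D"
  by (auto simp: tot_pos_def zero_prod_def)

text \<open>The empty multiset is allowed, unlike in \<open>quad_partitions\<close>: it is the base
  case of the recursion below. It never partitions a totally positive element, since its sum is
  0.\<close>

definition parts_msets :: "'a :: comm_monoid_add set \<Rightarrow> 'a \<Rightarrow> 'a multiset set" where
  "parts_msets S a = {M. set_mset M \<subseteq> S \<and> \<Sum>\<^sub># M = a}"

lemma parts_msets_insert: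
  fixes u a :: "'a :: ab_group_add"
  shows "parts_msets (insert u S) a = parts_msets S a \<union> add_mset u ` parts_msets (insert u S) (a - u)"
proof (intro equalityI subsetI)
  fix M assume M: "M \<in> parts_msets (insert u S) a"
  show "M \<in> parts_msets S a \<union> add_mset u ` parts_msets (insert u S) (a - u)"
  proof (cases "u \<in># M")
    case True
    then obtain M' where "M = add_mset u M'" by (metis multi_member_split)
    with M show ?thesis by (auto simp: parts_msets_def)
  next
    case False
    with M show ?thesis by (auto simp: parts_msets_def)
  qed
qed (auto simp: parts_msets_def)

text \<open>The two summands separate the multisets avoiding \<open>(u, v)\<close> from those
  containing it. The cone test prunes targets that no sum of totally positive parts can reach;
  \<open>0 < u\<close> and \<open>0 < x\<close> give termination.\<close>

function count_parts :: "int \<Rightarrow> (int \<times> int) list \<Rightarrow> int \<Rightarrow> int \<Rightarrow> nat" where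
  "count_parts D [] x y = (if x = 0 \<and> y = 0 then 1 else 0)"
| "count_parts D ((u, v) # ps) x y =
     (if x = 0 \<and> y = 0 then 1
      else if 0 < u \<and> 0 < x \<and> D * y * y < x * x
      then count_parts D ps x y + count_parts D ((u, v) # ps) (x - u) (y - v) else 0)"
  by pat_completeness auto
termination by (relation "Wellfounded.measure (\<lambda>(D, ps, x, y). length ps + nat x)") auto

declare count_parts.simps [simp del]

lemma parts_msets_tot_pos_0:
  assumes "0 \<le> D" "S \<subseteq> tot_pos D"
  shows "parts_msets S 0 = {{#}}"
proof -
  have "M = {#}" if "set_mset M \<subseteq> S" "\<Sum>\<^sub># M = 0" for M
    using sum_mset_tot_pos[OF assms(1), of M] zero_notin_tot_pos[of D] that assms(2) by force
  then show ?thesis by (auto simp: parts_msets_def)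
qed

lemma parts_msets_notin_tot_pos:
  assumes "0 \<le> D" "S \<subseteq> tot_pos D" "a \<noteq> 0" "a \<notin> tot_pos D"
  shows "parts_msets S a = {}"
proof -
  have False if "set_mset M \<subseteq> S" "\<Sum>\<^sub># M = a" for M
    using sum_mset_tot_pos[OF assms(1), of M] that assms by (cases "M = {#}") auto
  then show ?thesis by (auto simp: parts_msets_def)
qed

lemma count_parts_correct:
  assumes "0 \<le> D" "distinct ps" "set ps \<subseteq> tot_pos D"
  shows "finite (parts_msets (set ps) (x, y)) \<and>
         card (parts_msets (set ps) (x, y)) = count_parts D ps x y"
  using assms
proof (induction D ps x y rule: count_parts.induct)
  case (1 D x y)
  have "parts_msets {} (x, y) = (if x = 0 \<and> y = 0 then {{#}} else {})"
    by (auto simp: parts_msets_def zero_prod_def)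
  then show ?case by (simp add: count_parts.simps)
next
  case (2 D u v ps x y)
  show ?case
  proof (cases "x = 0 \<and> y = 0")
    case True
    then show ?thesis
      using parts_msets_tot_pos_0[OF 2(3,5)] by (subst count_parts.simps) (simp add: zero_prod_def)
  next
    case nz: False
    have u: "0 < u" using 2(5) by (auto simp: tot_pos_def)
    show ?thesis
    proof (cases "0 < x \<and> D * y * y < x * x")
      case True
      let ?A = "parts_msets (set ps) (x, y)" and ?B = "parts_msets (insert (u, v) (set ps)) (x - u, y - v)"
      have IH: "finite ?A" "card ?A = count_parts D ps x y"
           "finite ?B" "card ?B = count_parts D ((u, v) # ps) (x - u) (y - v)"
        using 2 nz u True by auto
      \<comment> \<open>Distinctness of the list enters here: \<open>(u, v)\<close> does not recur
        in \<open>ps\<close>, so the two classes are disjoint.\<close>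
      have "?A \<inter> add_mset (u, v) ` ?B = {}"
        using 2(4) by (auto simp: parts_msets_def)
      moreover have "card (add_mset (u, v) ` ?B) = card ?B"
        by (intro card_image) (auto simp: inj_on_def)
      moreover have "count_parts D ((u, v) # ps) x y =
          count_parts D ps x y + count_parts D ((u, v) # ps) (x - u) (y - v)"
        by (subst count_parts.simps) (use nz u True in auto)
      ultimately show ?thesis
        using parts_msets_insert[of "(u, v)" "set ps" "(x, y)"] IH
        by (simp add: card_Un_disjoint)
    next
      case False
      then have "(x, y) \<notin> tot_pos D" by (auto simp: tot_pos_def)
      with nz have "parts_msets (set ((u, v) # ps)) (x, y) = {}"
        using 2(3,5) by (intro parts_msets_notin_tot_pos[of D]) (auto simp: zero_prod_def)
      moreover have "count_parts D ((u, v) # ps) x y = 0"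
        by (subst count_parts.simps) (use nz False in auto)
      ultimately show ?thesis by simp
    qed
  qed
qed

definition pcount :: "int \<Rightarrow> int \<times> int \<Rightarrow> nat" where
  "pcount D a = card (parts_msets (tot_pos D) a)"

text \<open>Removing one occurrence of a part \<open>b\<close> leaves a multiset whose sum is zero
  or totally positive, so \<open>b\<close> passes the test in the hypothesis. This allows the
  infinite supply of parts to be cut down to a finite one.\<close>

lemma parts_msets_restrict:
  assumes "0 \<le> D" "S \<subseteq> tot_pos D" "\<And>b. b \<in> tot_pos D \<Longrightarrow> a - b \<in> tot_pos D \<or> a = b \<Longrightarrow> b \<in> S"
  shows "parts_msets (tot_pos D) a = parts_msets S a"
proof -
  have "set_mset M \<subseteq> S" if M: "set_mset M \<subseteq> tot_pos D" "\<Sum>\<^sub># M = a" for M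
  proof
    fix b assume "b \<in># M"
    then obtain M' where "M = add_mset b M'" by (metis multi_member_split)
    with M sum_mset_tot_pos[OF assms(1), of M'] have "b \<in> tot_pos D" "a - b \<in> tot_pos D \<or> a = b"
      by (cases "M' = {#}"; auto)+
    then show "b \<in> S" by (rule assms(3))
  qed
  with assms(2) show ?thesis by (auto simp: parts_msets_def)
qed

lemma pcount_eq_count_parts:
  assumes "0 \<le> D" "distinct ps" "set ps \<subseteq> tot_pos D"
    and "\<And>u v. (u, v) \<in> tot_pos D \<Longrightarrow> (x - u, y - v) \<in> tot_pos D \<or> (x = u \<and> y = v) \<Longrightarrow> (u, v) \<in> set ps"
  shows "pcount D (x, y) = count_parts D ps x y"
  unfolding pcount_def
  by (subst parts_msets_restrict[OF assms(1,3)])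
     (use assms count_parts_correct[OF assms(1-3)] in auto)

lemma tot_pos_snd_le:
  assumes "1 \<le> D" "(x, y) \<in> tot_pos D"
  shows "\<bar>y\<bar> < x"
proof -
  have "1 * (y * y) \<le> D * (y * y)" using assms by (intro mult_right_mono) auto
  then have "\<bar>y\<bar>\<^sup>2 < x\<^sup>2" using assms by (simp add: tot_pos_def power2_eq_square algebra_simps)
  then show ?thesis
    by (rule power_less_imp_less_base) (use assms in \<open>auto simp: tot_pos_def\<close>)
qed

lemma finite_parts_msets_tot_pos:
  assumes "1 \<le> D"
  shows "finite (parts_msets (tot_pos D) a)"
proof -
  let ?S = "{b \<in> tot_pos D. a - b \<in> tot_pos D \<or> a = b}"
  obtain x y where a: "a = (x, y)" by force
  \<comment> \<open>A part has trace at most \<open>x\<close>, and its second coordinate is bounded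
    by its trace.\<close>
  have "?S \<subseteq> {0..x} \<times> {-x..x}"
  proof
    fix b assume "b \<in> ?S"
    moreover obtain u v where b: "b = (u, v)" by force
    ultimately have "(u, v) \<in> tot_pos D" "u \<le> x" by (auto simp: tot_pos_def a)
    with tot_pos_snd_le[OF assms this(1)] show "b \<in> {0..x} \<times> {-x..x}" by (auto simp: b)
  qed
  then have "finite ?S" by (rule finite_subset) auto
  then obtain ps where "set ps = ?S" "distinct ps" using finite_distinct_list by blast
  moreover from this have "finite (parts_msets (set ps) (x, y))"
    using count_parts_correct[of D ps x y] assms by auto
  ultimately show ?thesis
    using parts_msets_restrict[of D ?S a] assms by (auto simp: a)
qed

text \<open>Appending \<open>c\<close> as an extra part is injective. Finiteness matters here, since
  \<open>card\<close> of an infinite set is 0.\<close>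

lemma pcount_add_mono:
  assumes "1 \<le> D" "c = 0 \<or> c \<in> tot_pos D"
  shows "pcount D a \<le> pcount D (a + c)"
proof (cases "c = 0")
  case False
  with assms have "add_mset c ` parts_msets (tot_pos D) a \<subseteq> parts_msets (tot_pos D) (a + c)"
    by (auto simp: parts_msets_def add.commute)
  then have "card (add_mset c ` parts_msets (tot_pos D) a) \<le> pcount D (a + c)"
    unfolding pcount_def using assms finite_parts_msets_tot_pos by (intro card_mono) auto
  then show ?thesis
    by (simp add: pcount_def card_image inj_on_def)
qed auto

lemma inj_on_image_mset:
  assumes "inj_on f S"
  shows "inj_on (image_mset f) {M. set_mset M \<subseteq> S}"
proof (rule inj_on_inverseI)
  fix M assume "M \<in> {M. set_mset M \<subseteq> S}"
  then have "image_mset (inv_into S f) (image_mset f M) = image_mset (\<lambda>x. x) M"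
    unfolding multiset.map_comp using assms by (intro image_mset_cong) auto
  then show "image_mset (inv_into S f) (image_mset f M) = M" by simp
qed

text \<open>Used for conjugation and for units, where the inverse map supplies the opposite
  inequality. Additivity is asked on \<open>tot_pos D\<close> only, where the integer divisions in
  \<open>unit_act\<close> are exact.\<close>

lemma pcount_le_image:
  assumes "1 \<le> D" "inj_on f (tot_pos D)" "f ` tot_pos D \<subseteq> tot_pos D" "a \<in> tot_pos D"
    and add: "\<And>b c. b \<in> tot_pos D \<Longrightarrow> c \<in> tot_pos D \<Longrightarrow> f (b + c) = f b + f c"
  shows "pcount D a \<le> pcount D (f a)"
proof -
  have sum: "\<Sum>\<^sub># (image_mset f M) = f (\<Sum>\<^sub># M)" if "set_mset M \<subseteq> tot_pos D" "M \<noteq> {#}" for M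
    using that
  proof (induction M)
    case (add b M)
    then show ?case
      using assms(5) sum_mset_tot_pos[of D M] assms(1) by (cases "M = {#}") auto
  qed auto
  have "image_mset f ` parts_msets (tot_pos D) a \<subseteq> parts_msets (tot_pos D) (f a)"
  proof
    fix N assume "N \<in> image_mset f ` parts_msets (tot_pos D) a"
    then obtain M where M: "N = image_mset f M" "set_mset M \<subseteq> tot_pos D" "\<Sum>\<^sub># M = a"
      by (auto simp: parts_msets_def)
    moreover have "M \<noteq> {#}" using M assms(4) zero_notin_tot_pos by auto
    ultimately show "N \<in> parts_msets (tot_pos D) (f a)"
      using sum[of M] assms(3) by (auto simp: parts_msets_def)
  qed
  then have "card (image_mset f ` parts_msets (tot_pos D) a) \<le> pcount D (f a)"
    unfolding pcount_def using assms finite_parts_msets_tot_pos by (intro card_mono) auto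
  moreover have "inj_on (image_mset f) (parts_msets (tot_pos D) a)"
    by (rule inj_on_subset[OF inj_on_image_mset[OF assms(2)]]) (auto simp: parts_msets_def)
  ultimately show ?thesis
    by (simp add: pcount_def card_image)
qed

lemma tot_pos_conj: "(x, y) \<in> tot_pos D \<Longrightarrow> (x, - y) \<in> tot_pos D"
  by (auto simp: tot_pos_def)

lemma pcount_conj:
  assumes "1 \<le> D" "(x, y) \<in> tot_pos D"
  shows "pcount D (x, - y) = pcount D (x, y)"
proof -
  have *: "pcount D (u, v) \<le> pcount D (u, - v)" if "(u, v) \<in> tot_pos D" for u v
  proof -
    have "pcount D (u, v) \<le> pcount D ((\<lambda>(x, y). (x, - y)) (u, v))"
      using assms(1) that by (intro pcount_le_image) (auto simp: tot_pos_conj inj_on_def)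
    then show ?thesis by simp
  qed
  show ?thesis using *[of x y] *[of x "-y"] assms by (auto simp: tot_pos_conj)
qed

subsection \<open>Reduction by units\<close>

text \<open>Multiplication by \<open>(u + v\<surd>D) / 2\<close>, which has norm 1 when \<open>u\<^sup>2 - Dv\<^sup>2 = 4\<close>.\<close>
definition unit_act :: "int \<Rightarrow> int \<Rightarrow> int \<Rightarrow> int \<times> int \<Rightarrow> int \<times> int" where
  "unit_act D u v = (\<lambda>(x, y). ((u * x + D * v * y) div 2, (u * y + v * x) div 2))"

context
  fixes D u v :: int
  assumes D: "1 \<le> D" and u: "0 < u" and norm: "u * u - D * v * v = 4"
begin

lemma unit_act_coords:
  assumes "(x, y) \<in> tot_pos D"
  obtains p q where "unit_act D u v (x, y) = (p, q)" "u * x + D * v * y = 2 * p" "u * y + v * x = 2 * q"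
proof -
  have "4 dvd u * u - D * v * v" by (simp add: norm)
  moreover have "4 dvd x * x - D * y * y" using assms by (simp add: tot_pos_def)
  ultimately have "even (u * x + D * v * y)" "even (u * y + v * x)"
    by (rule even_product_coords)+
  then show thesis
    using that[of "(u * x + D * v * y) div 2" "(u * y + v * x) div 2"]
    by (simp add: unit_act_def)
qed

lemma unit_act_tot_pos:
  assumes "a \<in> tot_pos D"
  shows "unit_act D u v a \<in> tot_pos D"
proof -
  obtain x y where a: "a = (x, y)" by force
  obtain p q where pq: "unit_act D u v (x, y) = (p, q)" "u * x + D * v * y = 2 * p" "u * y + v * x = 2 * q"
    using unit_act_coords[of x y] assms a by auto
  have "\<bar>D * v * y\<bar> < u * x"
    using assms D u norm by (intro abs_product_less) (auto simp: a tot_pos_def)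
  with pq(2) have "0 < p" by linarith
  \<comment> \<open>Multiplicativity of the norm with the halves cleared; the unit contributes the
    factor 4 that cancels.\<close>
  have "4 * (p * p - D * q * q) = (2 * p) * (2 * p) - D * (2 * q) * (2 * q)"
    by (simp add: algebra_simps)
  also have "\<dots> = (u * u - D * v * v) * (x * x - D * y * y)"
    unfolding pq(2,3)[symmetric] by (simp add: algebra_simps)
  finally have "p * p - D * q * q = x * x - D * y * y"
    unfolding norm by simp
  with \<open>0 < p\<close> assms have "(p, q) \<in> tot_pos D"
    by (simp add: a tot_pos_def)
  then show ?thesis by (simp add: a pq(1))
qed

end

text \<open>A unit of norm 1 has its conjugate as inverse, hence the sign change in
  \<open>v\<close>.\<close>

lemma unit_act_inverse:
  assumes "1 \<le> D" "0 < u" "u * u - D * v * v = 4" "a \<in> tot_pos D"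
  shows "unit_act D u (- v) (unit_act D u v a) = a"
proof -
  obtain x y where a: "a = (x, y)" by force
  obtain p q where pq: "unit_act D u v (x, y) = (p, q)" "u * x + D * v * y = 2 * p" "u * y + v * x = 2 * q"
    using unit_act_coords[OF assms(1-3), of x y] assms(4) a by auto
  have "2 * (u * p + D * (- v) * q) = u * (2 * p) - D * v * (2 * q)"
       "2 * (u * q + (- v) * p) = u * (2 * q) - v * (2 * p)"
    by (simp_all add: algebra_simps)
  moreover have "u * (2 * p) - D * v * (2 * q) = (u * u - D * v * v) * x"
       "u * (2 * q) - v * (2 * p) = (u * u - D * v * v) * y"
    unfolding pq(2,3)[symmetric] by (simp_all add: algebra_simps)
  ultimately have "u * p + D * (- v) * q = 2 * x" "u * q + (- v) * p = 2 * y"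
    unfolding assms(3) by linarith+
  then have "unit_act D u (- v) (p, q) = (x, y)"
    by (simp add: unit_act_def)
  then show ?thesis by (simp add: a pq(1))
qed

lemma pcount_unit_act:
  assumes "1 \<le> D" "0 < u" "u * u - D * v * v = 4" "a \<in> tot_pos D"
  shows "pcount D (unit_act D u v a) = pcount D a"
proof -
  have le: "pcount D b \<le> pcount D (unit_act D u w b)"
    if w: "u * u - D * w * w = 4" and b: "b \<in> tot_pos D" for w b
  proof (rule pcount_le_image)
    show "inj_on (unit_act D u w) (tot_pos D)"
      using unit_act_inverse[OF assms(1,2) w] by (rule inj_on_inverseI)
    show "unit_act D u w ` tot_pos D \<subseteq> tot_pos D"
      using unit_act_tot_pos[OF assms(1,2) w] by blast
    fix c d assume c: "c \<in> tot_pos D" and d: "d \<in> tot_pos D"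
    obtain x y x' y' where xy: "c = (x, y)" "d = (x', y')" by force
    obtain p q where pq: "unit_act D u w (x, y) = (p, q)" "u * x + D * w * y = 2 * p" "u * y + w * x = 2 * q"
      using unit_act_coords[OF assms(1,2) w, of x y] c xy by auto
    obtain p' q' where pq': "unit_act D u w (x', y') = (p', q')" "u * x' + D * w * y' = 2 * p'" "u * y' + w * x' = 2 * q'"
      using unit_act_coords[OF assms(1,2) w, of x' y'] d xy by auto
    have "u * (x + x') + D * w * (y + y') = 2 * (p + p')"
      "u * (y + y') + w * (x + x') = 2 * (q + q')"
      using pq(2,3) pq'(2,3) by (simp_all add: algebra_simps)
    then have "unit_act D u w (x + x', y + y') = (p + p', q + q')"
      by (simp add: unit_act_def)
    then show "unit_act D u w (c + d) = unit_act D u w c + unit_act D u w d"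
      using pq pq' xy by simp
  qed (use assms b in auto)
  have "pcount D (unit_act D u v a) \<le> pcount D (unit_act D u (- v) (unit_act D u v a))"
    using assms by (intro le unit_act_tot_pos) auto
  also have "\<dots> = pcount D a"
    by (simp add: unit_act_inverse[OF assms])
  finally show ?thesis
    using le[OF assms(3,4)] by simp
qed

text \<open>Descent on the trace. After conjugation \<open>y\<close> is nonnegative, and the inverse
  unit sends the trace \<open>x\<close> to \<open>(u * x - D * v * y) / 2\<close>, which is smaller
  than \<open>x\<close> exactly when the last inequality fails. For \<open>v > 0\<close> that
  inequality reads y / x <= v / (u + 2), the slope of 1 plus the unit.\<close>

lemma exists_reduced:
  assumes "1 \<le> D" "0 < u" "u * u - D * v * v = 4" "a \<in> tot_pos D"
  shows "\<exists>x y. (x, y) \<in> tot_pos D \<and> pcount D (x, y) = pcount D a \<and> 0 \<le> y \<and> D * v * y \<le> (u - 2) * x"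
  using assms(4)
proof (induction "nat (fst a)" arbitrary: a rule: less_induct)
  case less
  obtain x y where a: "a = (x, y)" by force
  have x: "0 < x" using less.prems by (auto simp: a tot_pos_def)
  have b: "(x, \<bar>y\<bar>) \<in> tot_pos D" "pcount D (x, \<bar>y\<bar>) = pcount D a"
    using less.prems tot_pos_conj[of x y D] pcount_conj[OF assms(1), of x y] by (auto simp: a abs_if)
  show ?case
  proof (cases "D * v * \<bar>y\<bar> \<le> (u - 2) * x")
    case True
    with b show ?thesis by (intro exI[of _ x] exI[of _ "\<bar>y\<bar>"]) auto
  next
    case False
    have v': "u * u - D * (- v) * (- v) = 4" using assms(3) by simp
    obtain p q where pq: "unit_act D u (- v) (x, \<bar>y\<bar>) = (p, q)" "u * x + D * (- v) * \<bar>y\<bar> = 2 * p"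
      using unit_act_coords[OF assms(1,2) v' b(1)] by metis
    have "(p, q) \<in> tot_pos D" "pcount D (p, q) = pcount D (x, \<bar>y\<bar>)"
      using unit_act_tot_pos[OF assms(1,2) v' b(1)] pcount_unit_act[OF assms(1,2) v' b(1)] pq(1) by auto
    moreover have "p < x"
      using False pq(2) by (simp add: algebra_simps)
    then have "nat (fst (p, q)) < nat (fst a)"
      using x by (simp add: a)
    ultimately show ?thesis
      using less.hyps[of "(p, q)"] b(2) by auto
  qed
qed

section \<open>Lattice points as totally positive integers of the field\<close>

definition quad_elt :: "int \<Rightarrow> int \<times> int \<Rightarrow> real" where
  "quad_elt D = (\<lambda>(x, y). (of_int x + of_int y * sqrt (of_int D)) / 2)"

context
  fixes D :: int
  assumes D: "D \<ge> 2" "squarefree D"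
begin

lemma inj_quad_elt: "inj (quad_elt D)"
proof (rule injI)
  fix a b assume eq: "quad_elt D a = quad_elt D b"
  obtain x y x' y' where ab: "a = (x, y)" "b = (x', y')" by force
  have "of_int x + of_int y * sqrt (of_int D) = of_int x' + of_int y' * sqrt (of_int D)"
    using eq by (simp add: ab quad_elt_def)
  then have "real_of_int x = of_int x'" "real_of_int y = of_int y'"
    using quad_coeffs_unique[OF D, of "of_int x" "of_int y" "of_int x'" "of_int y'"] by auto
  then show "a = b" by (simp add: ab)
qed

lemma quad_elt_sum_mset: "\<Sum>\<^sub># (image_mset (quad_elt D) M) = quad_elt D (\<Sum>\<^sub># M)"
proof (induction M)
  case (add a M)
  have "quad_elt D (b + c) = quad_elt D b + quad_elt D c" for b c
    by (cases b; cases c) (simp add: quad_elt_def algebra_simps add_divide_distrib)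
  with add show ?case by simp
qed (simp add: quad_elt_def zero_prod_def)

lemma quad_integers_pos_eq: "quad_integers_pos D = quad_elt D ` tot_pos D"
proof -
  have pos: "(0 < quad_elt D (x, y) \<and> 0 < quad_conj D (quad_elt D (x, y))) \<longleftrightarrow> 0 < x \<and> D * y * y < x * x"
    for x y
  proof -
    let ?s = "sqrt (of_int D)"
    have "quad_elt D (x, y) = of_int x / 2 + of_int y / 2 * ?s"
      by (simp add: quad_elt_def add_divide_distrib)
    then have conj: "quad_conj D (quad_elt D (x, y)) = of_int x / 2 - of_int y / 2 * ?s"
      using quad_conj_eq[OF D, of "of_int x / 2" "of_int y / 2"] by simp
    \<comment> \<open>Both conjugates are positive exactly when the irrational part \<open>t\<close>
      is smaller in absolute value than \<open>x\<close>; squaring turns this into an inequality of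
      integers.\<close>
    define t where "t = of_int y * ?s"
    have "(0 < quad_elt D (x, y) \<and> 0 < quad_conj D (quad_elt D (x, y))) \<longleftrightarrow> \<bar>t\<bar> < of_int x"
    proof -
      have "of_int y / 2 * ?s = t / 2" by (simp add: t_def)
      moreover have "quad_elt D (x, y) = (of_int x + t) / 2" by (simp add: quad_elt_def t_def)
      ultimately show ?thesis unfolding conj by (auto simp: abs_less_iff)
    qed
    also have "\<dots> \<longleftrightarrow> 0 < x \<and> \<bar>t\<bar> < \<bar>of_int x\<bar>"
      by auto
    also have "\<bar>t\<bar> < \<bar>of_int x\<bar> \<longleftrightarrow> t\<^sup>2 < (of_int x)\<^sup>2"
      by (simp only: abs_le_square_iff flip: not_le)
    also have "t\<^sup>2 = of_int (D * y * y)"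
      using D by (simp add: t_def power_mult_distrib power2_eq_square)
    also have "of_int (D * y * y) < (of_int x :: real)\<^sup>2 \<longleftrightarrow> D * y * y < x * x"
      by (metis of_int_less_iff of_int_power power2_eq_square)
    finally show ?thesis .
  qed
  have "quad_integers D = {quad_elt D (x, y) |x y. 4 dvd x * x - D * y * y}"
    using quad_integers_eq[OF D] by (simp add: quad_elt_def)
  then have "quad_integers_pos D = {quad_elt D (x, y) |x y. 4 dvd x * x - D * y * y \<and>
      0 < quad_elt D (x, y) \<and> 0 < quad_conj D (quad_elt D (x, y))}"
    unfolding quad_integers_pos_def by auto
  then show ?thesis
    unfolding pos tot_pos_def by auto
qed

lemma num_partitions_quad_elt:
  assumes "a \<in> tot_pos D"
  shows "num_partitions D (quad_elt D a) = pcount D a"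
proof -
  have "quad_partitions D (quad_elt D a) = image_mset (quad_elt D) ` parts_msets (tot_pos D) a"
  proof (intro equalityI subsetI)
    fix N assume "N \<in> quad_partitions D (quad_elt D a)"
    then have N: "set_mset N \<subseteq> quad_elt D ` tot_pos D" "\<Sum>\<^sub># N = quad_elt D a"
      by (auto simp: quad_partitions_def quad_integers_pos_eq)
    define M where "M = image_mset (inv (quad_elt D)) N"
    have "image_mset (quad_elt D) M = image_mset (\<lambda>x. x) N"
      unfolding M_def multiset.map_comp using N(1)
      by (intro image_mset_cong) (auto simp: inj_quad_elt)
    then have NM: "N = image_mset (quad_elt D) M" by simp
    have "set_mset M \<subseteq> tot_pos D"
      using N(1) by (auto simp: M_def inj_quad_elt)
    moreover have "\<Sum>\<^sub># M = a"
      using N(2) inj_quad_elt by (simp add: NM quad_elt_sum_mset inj_eq)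
    ultimately show "N \<in> image_mset (quad_elt D) ` parts_msets (tot_pos D) a"
      by (auto simp: NM parts_msets_def)
  next
    fix N assume "N \<in> image_mset (quad_elt D) ` parts_msets (tot_pos D) a"
    then obtain M where M: "N = image_mset (quad_elt D) M" "set_mset M \<subseteq> tot_pos D" "\<Sum>\<^sub># M = a"
      by (auto simp: parts_msets_def)
    moreover have "M \<noteq> {#}" using M assms zero_notin_tot_pos by auto
    ultimately show "N \<in> quad_partitions D (quad_elt D a)"
      by (auto simp: quad_partitions_def quad_integers_pos_eq quad_elt_sum_mset)
  qed
  moreover have "inj (image_mset (quad_elt D))"
    using inj_quad_elt by (rule multiset.inj_map)
  ultimately show ?thesis
    by (simp add: num_partitions_def pcount_def card_image inj_on_subset)
qed

end

lemma missing_discs_iff: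
  "D \<in> missing_discs m \<longleftrightarrow> D \<ge> 2 \<and> squarefree D \<and> (\<forall>a\<in>tot_pos D. pcount D a \<noteq> m)"
proof (cases "D \<ge> 2 \<and> squarefree D")
  case True
  then show ?thesis
    by (simp add: missing_discs_def quad_integers_pos_eq num_partitions_quad_elt)
qed (auto simp: missing_discs_def)

subsection \<open>Explicit counts\<close>

text \<open>Nested conditionals instead of conjunctions make the simplifier stop at the first failing test.\<close>
definition is_part :: "int \<Rightarrow> int \<Rightarrow> int \<Rightarrow> int \<Rightarrow> int \<Rightarrow> bool" where
  "is_part D x y u v \<longleftrightarrow>
     (if D * v * v < u * u
      then if x = u \<and> y = v then True
        else if D * (y - v) * (y - v) < (x - u) * (x - u) then (u * u - D * v * v) mod 4 = 0 else False
      else False)"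

text \<open>\<open>s\<close> is meant as an integer lower bound for sqrt D: then every totally
  positive \<open>(u, v)\<close> has |v| at most \<open>u div s\<close>.\<close>

definition parts_list :: "int \<Rightarrow> int \<Rightarrow> int \<Rightarrow> int \<Rightarrow> (int \<times> int) list" where
  "parts_list s D x y =
     concat (map (\<lambda>u. map (Pair u) (filter (is_part D x y u) [- (u div s)..u div s])) [1..x])"

lemma distinct_concat_map_Pair:
  "distinct us \<Longrightarrow> (\<And>u. distinct (vs u)) \<Longrightarrow> distinct (concat (map (\<lambda>u. map (Pair u) (vs u)) us))"
  by (induction us) (auto simp: distinct_map inj_on_def)

lemma tot_pos_abs_snd_le:
  assumes "0 < s" "s * s \<le> D" "(x, y) \<in> tot_pos D"
  shows "\<bar>y\<bar> \<le> x div s"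
proof -
  have "(s * \<bar>y\<bar>)\<^sup>2 = (s * s) * (y * y)" by (simp add: power2_eq_square algebra_simps)
  also have "\<dots> \<le> D * (y * y)" using assms(2) by (intro mult_right_mono) auto
  also have "\<dots> < x\<^sup>2" using assms(3) by (simp add: tot_pos_def power2_eq_square algebra_simps)
  finally have "s * \<bar>y\<bar> < x"
    by (rule power_less_imp_less_base) (use assms in \<open>auto simp: tot_pos_def\<close>)
  then have "(s * \<bar>y\<bar>) div s \<le> x div s"
    using assms(1) by (intro zdiv_mono1) auto
  then show ?thesis using assms(1) by simp
qed

text \<open>The list need only consist of totally positive elements and contain every possible part.
  This reduces an exact partition number to a computation.\<close>

lemma pcount_code:
  assumes "0 < s" "s * s \<le> D" "(x, y) \<in> tot_pos D"
  shows "pcount D (x, y) = count_parts D (parts_list s D x y) x y"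
proof (rule pcount_eq_count_parts)
  show "0 \<le> D" using assms(1,2) by (meson less_imp_le mult_nonneg_nonneg order_trans)
  show "distinct (parts_list s D x y)"
    unfolding parts_list_def by (intro distinct_concat_map_Pair) auto
  show "set (parts_list s D x y) \<subseteq> tot_pos D"
    using assms(3) by (auto simp: parts_list_def is_part_def tot_pos_def mod_eq_0_iff_dvd split: if_splits)
  fix u v assume uv: "(u, v) \<in> tot_pos D" "(x - u, y - v) \<in> tot_pos D \<or> (x = u \<and> y = v)"
  have "\<bar>v\<bar> \<le> u div s" by (rule tot_pos_abs_snd_le[OF assms(1,2) uv(1)])
  moreover have "is_part D x y u v"
    using uv by (auto simp: is_part_def tot_pos_def mod_eq_0_iff_dvd)
  moreover have "u \<le> x" "0 < u" using uv by (auto simp: tot_pos_def)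
  ultimately show "(u, v) \<in> set (parts_list s D x y)"
    by (auto simp: parts_list_def image_iff abs_le_iff)
qed

text \<open>If \<open>k / m > \<surd>D\<close>, this linear condition implies that the difference is zero or totally positive.\<close>
definition dominates :: "int \<Rightarrow> int \<Rightarrow> int \<times> int \<Rightarrow> int \<times> int \<Rightarrow> bool" where
  "dominates k m = (\<lambda>(b, c) (x, y). (b = x \<and> c = y) \<or> (b < x \<and> k * \<bar>y - c\<bar> \<le> m * (x - b)))"

lemma dominates_same_row: "b \<le> x \<Longrightarrow> 0 \<le> m \<Longrightarrow> dominates k m (b, y) (x, y)"
  by (auto simp: dominates_def)

lemma pcount_dominates:
  assumes "1 \<le> D" "0 < k" "D * m * m < k * k" "a \<in> tot_pos D" "b \<in> tot_pos D" "dominates k m b a"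
  shows "pcount D b \<le> pcount D a"
proof -
  obtain x y b' c where ab: "a = (x, y)" "b = (b', c)" by force
  have "a - b = 0 \<or> a - b \<in> tot_pos D"
  proof (cases "b' = x \<and> c = y")
    case True
    then show ?thesis by (simp add: ab)
  next
    case False
    with assms(6) have *: "b' < x" "k * \<bar>y - c\<bar> \<le> m * (x - b')"
      by (auto simp: dominates_def ab)
    have "D * (y - c) * (y - c) < (x - b') * (x - b')"
    proof (cases "y = c")
      case False
      have "(k * k) * (D * (y - c)\<^sup>2) = D * (k * \<bar>y - c\<bar>)\<^sup>2"
        by (simp add: power2_eq_square algebra_simps)
      also have "\<dots> \<le> D * (m * (x - b'))\<^sup>2"
        using * assms(1,2) by (intro mult_left_mono power_mono) auto
      also have "\<dots> = (D * m * m) * (x - b')\<^sup>2"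
        by (simp add: power2_eq_square algebra_simps)
      also have "\<dots> < (k * k) * (x - b')\<^sup>2"
        using * assms(3) by (intro mult_strict_right_mono) auto
      finally have "D * (y - c)\<^sup>2 < (x - b')\<^sup>2"
        using assms(2) by (simp add: mult_less_cancel_left)
      then show ?thesis by (simp add: power2_eq_square mult.assoc)
    qed (use * in auto)
    moreover have "4 dvd (x - b') * (x - b') - D * (y - c) * (y - c)"
    proof -
      have "4 dvd x * x - D * y * y" "4 dvd b' * b' - D * c * c"
        using assms(4,5) by (auto simp: ab tot_pos_def)
      moreover from this have "even (x * b' + D * y * c)"
        by (rule even_product_coords)
      then have "even (x * b' - D * y * c)" by simp
      then obtain j where "x * b' - D * y * c = 2 * j" by (elim evenE)
      then have "(x - b') * (x - b') - D * (y - c) * (y - c) =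
          (x * x - D * y * y) + (b' * b' - D * c * c) - 4 * j"
        by (simp add: algebra_simps)
      ultimately show ?thesis by simp
    qed
    ultimately show ?thesis using *(1) by (simp add: ab tot_pos_def)
  qed
  then show ?thesis
    using pcount_add_mono[OF assms(1), of "a - b" b] by auto
qed

text \<open>A finite certificate for one field: elements of \<open>small\<close> are counted
  exactly, and monotonicity passes the lower bound \<open>N\<close> from an entry of
  \<open>big\<close> to everything it dominates. \<open>s\<close> and the ratio \<open>k / m\<close>
  approximate sqrt D from below and above; the first bounds the enumeration of parts, the second
  makes domination a linear condition.\<close>

lemma pcount_spectrum:
  fixes u v s k m :: int
  assumes a: "a \<in> tot_pos D"
    and unit: "0 < u" "u * u - D * v * v = 4"
    and s: "0 < s" "s * s \<le> D"
    and slope: "0 < k" "D * m * m < k * k"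
    and reduced: "\<And>x y. (x, y) \<in> tot_pos D \<Longrightarrow> 0 \<le> y \<Longrightarrow> D * v * y \<le> (u - 2) * x \<Longrightarrow>
      (x, y) \<in> set small \<or> (\<exists>b\<in>set big. dominates k m b (x, y))"
    and small: "list_all (\<lambda>(x, y). count_parts D (parts_list s D x y) x y \<in> set vals) small"
    and big: "list_all (\<lambda>(x, y). 0 < x \<and> D * y * y < x * x \<and> (x * x - D * y * y) mod 4 = 0 \<and>
      N \<le> count_parts D (parts_list s D x y) x y) big"
  shows "pcount D a \<in> set vals \<or> N \<le> pcount D a"
proof -
  have "0 < s * s" using s(1) by simp
  with s(2) have D: "1 \<le> D" by linarith
  obtain x y where xy: "(x, y) \<in> tot_pos D" "pcount D (x, y) = pcount D a" "0 \<le> y" "D * v * y \<le> (u - 2) * x"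
    using exists_reduced[OF D unit a] by blast
  from reduced[OF xy(1,3,4)] show ?thesis
  proof
    assume "(x, y) \<in> set small"
    with small have "pcount D (x, y) \<in> set vals"
      by (auto simp: list_all_iff pcount_code[OF s xy(1)])
    then show ?thesis by (simp add: xy(2))
  next
    assume "\<exists>b\<in>set big. dominates k m b (x, y)"
    then obtain b c where bc: "(b, c) \<in> set big" "dominates k m (b, c) (x, y)" by force
    with big have "(b, c) \<in> tot_pos D" "N \<le> count_parts D (parts_list s D b c) b c"
      by (auto simp: list_all_iff tot_pos_def mod_eq_0_iff_dvd)
    then have "N \<le> pcount D (b, c)" by (simp add: pcount_code[OF s])
    also have "\<dots> \<le> pcount D (x, y)"
      by (rule pcount_dominates[OF D slope xy(1) \<open>(b, c) \<in> tot_pos D\<close> bc(2)])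
    finally show ?thesis by (simp add: xy(2))
  qed
qed

section \<open>Partition numbers below 12 for D = 2, 3, 5, 6, 7, 13, 21\<close>

lemma tot_pos_coords_congruent:
  assumes "(x, y) \<in> tot_pos D" "odd D"
  shows "even (x - y)"
proof -
  have "even (x * x - D * y * y)"
    using assms(1) dvd_trans[of 2 "4 :: int"] by (simp add: tot_pos_def del: even_diff even_mult_iff)
  with assms(2) show ?thesis by auto
qed

lemma tot_pos_coords_even:
  assumes "(x, y) \<in> tot_pos D" "D mod 4 = 2 \<or> D mod 4 = 3"
  shows "even x" "even y"
proof -
  have sq: "(z * z) mod 4 = (if even z then 0 else 1)" for z :: int
  proof (cases "even z")
    case True
    then obtain w where "z = 2 * w" by (elim evenE)
    then show ?thesis by simp
  next
    case False
    then obtain w where "z = 2 * w + 1" by (elim oddE)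
    then have eq: "z * z = 1 + 4 * (w * w + w)" by (simp add: algebra_simps)
    have "(1 + 4 * j) mod 4 = 1" for j :: int by presburger
    then show ?thesis using False by (simp only: eq if_False)
  qed
  have "(x * x - D * y * y) mod 4 = 0"
    using assms(1) by (simp add: tot_pos_def mod_eq_0_iff_dvd)
  also have "(x * x - D * y * y) mod 4 = ((x * x) mod 4 - ((D mod 4) * ((y * y) mod 4)) mod 4) mod 4"
    by (simp only: mod_diff_eq mod_mult_eq mult.assoc)
  finally show "even x" "even y"
    using assms(2) unfolding sq by (auto split: if_splits)
qed

text \<open>The pattern for all seven fields: the reduced cone is cut into rows of constant
  \<open>y\<close>. In each row up to that of the last entry of \<open>big\<close>,
  \<open>small\<close> lists the reduced elements before the entry of \<open>big\<close>; all higher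
  rows are dominated by the last entry of \<open>big\<close> alone.\<close>

lemma pcount_spectrum_2:
  assumes "a \<in> tot_pos 2"
  shows "pcount 2 a \<in> set [1, 2, 3, 4, 6, 8, 10] \<or> 12 \<le> pcount 2 a"
\<comment> \<open>\<open>u\<close> and \<open>v\<close> encode the unit 3 + 2 sqrt 2, whose
  coordinate ratio 3 / 2 exceeds sqrt 2 and serves as slope.\<close>
proof (rule pcount_spectrum[where u = 6 and v = 4 and s = 1 and k = 3 and m = 2 and
    small = "[(2, 0), (4, 0), (4, 2), (6, 0), (6, 2), (8, 0), (8, 2), (8, 4), (10, 0), (10, 2), (10, 4), (12, 6)]" and
    big = "[(12, 0), (12, 2), (12, 4), (14, 6), (16, 8)]"])
  fix x y :: int assume xy: "(x, y) \<in> tot_pos 2" "0 \<le> y" "2 * 4 * y \<le> (6 - 2) * x"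
  from tot_pos_coords_even[OF xy(1)] have par: "even x \<and> even y" by simp
  have reg: "8 * y \<le> 4 * x" using xy(3) by simp
  have "0 < x" using xy(1) by (simp add: tot_pos_def)
  consider "y = 0" | "y = 2" | "y = 4" | "y = 6" | "y = 8" | "10 \<le> y"
    using xy(2) par by atomize_elim presburger
  then show "(x, y) \<in> set [(2, 0), (4, 0), (4, 2), (6, 0), (6, 2), (8, 0), (8, 2), (8, 4), (10, 0), (10, 2), (10, 4), (12, 6)] \<or>
      (\<exists>b\<in>set [(12, 0), (12, 2), (12, 4), (14, 6), (16, 8)]. dominates 3 2 b (x, y))"
  proof cases
    case 1
    then have "x = 2 \<or> x = 4 \<or> x = 6 \<or> x = 8 \<or> x = 10 \<or> 12 \<le> x"
      using reg par \<open>0 < x\<close> by presburger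
    with 1 dominates_same_row[of 12 x 2 3 0] show ?thesis by auto
  next
    case 2
    then have "x = 4 \<or> x = 6 \<or> x = 8 \<or> x = 10 \<or> 12 \<le> x"
      using reg par \<open>0 < x\<close> by presburger
    with 2 dominates_same_row[of 12 x 2 3 2] show ?thesis by auto
  next
    case 3
    then have "x = 8 \<or> x = 10 \<or> 12 \<le> x"
      using reg par \<open>0 < x\<close> by presburger
    with 3 dominates_same_row[of 12 x 2 3 4] show ?thesis by auto
  next
    case 4
    then have "x = 12 \<or> 14 \<le> x"
      using reg par \<open>0 < x\<close> by presburger
    with 4 dominates_same_row[of 14 x 2 3 6] show ?thesis by auto
  next
    case 5
    then have "16 \<le> x"
      using reg par \<open>0 < x\<close> by presburger
    with 5 dominates_same_row[of 16 x 2 3 8] show ?thesis by auto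
  next
    case 6
    with reg have "16 < x" by linarith
    \<comment> \<open>Reducedness gives x >= 2 y, so 2 (x - 16) >= 4 (y - 8).\<close>
    moreover have "3 * (y - 8) \<le> 2 * (x - 16)"
      using reg 6 by (simp add: algebra_simps)
    ultimately have "dominates 3 2 (16, 8) (x, y)"
      using 6 by (simp add: dominates_def)
    then show ?thesis by simp
  qed
\<comment> \<open>What remains is numerical: the unit equation, the approximations of sqrt 2, and
  the partition counts of the listed elements.\<close>
qed (rule assms, code_simp+)

lemma pcount_spectrum_3:
  assumes "a \<in> tot_pos 3"
  shows "pcount 3 a \<in> set [1, 2, 3, 4, 6, 7, 9, 10] \<or> 12 \<le> pcount 3 a"
\<comment> \<open>The unit is 2 + sqrt 3, with slope 2.\<close>
proof (rule pcount_spectrum[where u = 4 and v = 2 and s = 1 and k = 2 and m = 1 and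
    small = "[(2, 0), (4, 0), (6, 0), (6, 2), (8, 0), (8, 2), (10, 0), (10, 2), (12, 4)]" and
    big = "[(12, 0), (12, 2), (14, 4)]"])
  fix x y :: int assume xy: "(x, y) \<in> tot_pos 3" "0 \<le> y" "3 * 2 * y \<le> (4 - 2) * x"
  from tot_pos_coords_even[OF xy(1)] have par: "even x \<and> even y" by simp
  have reg: "6 * y \<le> 2 * x" using xy(3) by simp
  have "0 < x" using xy(1) by (simp add: tot_pos_def)
  consider "y = 0" | "y = 2" | "y = 4" | "6 \<le> y"
    using xy(2) par by atomize_elim presburger
  then show "(x, y) \<in> set [(2, 0), (4, 0), (6, 0), (6, 2), (8, 0), (8, 2), (10, 0), (10, 2), (12, 4)] \<or>
      (\<exists>b\<in>set [(12, 0), (12, 2), (14, 4)]. dominates 2 1 b (x, y))"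
  proof cases
    case 1
    then have "x = 2 \<or> x = 4 \<or> x = 6 \<or> x = 8 \<or> x = 10 \<or> 12 \<le> x"
      using reg par \<open>0 < x\<close> by presburger
    with 1 dominates_same_row[of 12 x 1 2 0] show ?thesis by auto
  next
    case 2
    then have "x = 6 \<or> x = 8 \<or> x = 10 \<or> 12 \<le> x"
      using reg par \<open>0 < x\<close> by presburger
    with 2 dominates_same_row[of 12 x 1 2 2] show ?thesis by auto
  next
    case 3
    then have "x = 12 \<or> 14 \<le> x"
      using reg par \<open>0 < x\<close> by presburger
    with 3 dominates_same_row[of 14 x 1 2 4] show ?thesis by auto
  next
    case 4
    with reg have "14 < x" by linarith
    moreover have "2 * (y - 4) \<le> 1 * (x - 14)"
      using reg 4 by (simp add: algebra_simps)
    ultimately have "dominates 2 1 (14, 4) (x, y)"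
      using 4 by (simp add: dominates_def)
    then show ?thesis by simp
  qed
qed (rule assms, code_simp+)

lemma pcount_spectrum_5:
  assumes "a \<in> tot_pos 5"
  shows "pcount 5 a \<in> set [1, 2, 4, 8, 9, 10] \<or> 12 \<le> pcount 5 a"
\<comment> \<open>The unit is (3 + sqrt 5) / 2. The slope 9 / 4 is the coordinate ratio of its cube
  9 + 4 sqrt 5.\<close>
proof (rule pcount_spectrum[where u = 3 and v = 1 and s = 2 and k = 9 and m = 4 and
    small = "[(2, 0), (4, 0), (5, 1), (6, 0), (7, 1), (8, 0), (9, 1), (10, 2)]" and
    big = "[(10, 0), (11, 1), (12, 2)]"])
  fix x y :: int assume xy: "(x, y) \<in> tot_pos 5" "0 \<le> y" "5 * 1 * y \<le> (3 - 2) * x"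
  from tot_pos_coords_congruent[OF xy(1)] have par: "even (x - y)" by simp
  have reg: "5 * y \<le> 1 * x" using xy(3) by simp
  have "0 < x" using xy(1) by (simp add: tot_pos_def)
  consider "y = 0" | "y = 1" | "y = 2" | "3 \<le> y"
    using xy(2) par by atomize_elim presburger
  then show "(x, y) \<in> set [(2, 0), (4, 0), (5, 1), (6, 0), (7, 1), (8, 0), (9, 1), (10, 2)] \<or>
      (\<exists>b\<in>set [(10, 0), (11, 1), (12, 2)]. dominates 9 4 b (x, y))"
  proof cases
    case 1
    then have "x = 2 \<or> x = 4 \<or> x = 6 \<or> x = 8 \<or> 10 \<le> x"
      using reg par \<open>0 < x\<close> by presburger
    with 1 dominates_same_row[of 10 x 4 9 0] show ?thesis by auto
  next
    case 2
    then have "x = 5 \<or> x = 7 \<or> x = 9 \<or> 11 \<le> x"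
      using reg par \<open>0 < x\<close> by presburger
    with 2 dominates_same_row[of 11 x 4 9 1] show ?thesis by auto
  next
    case 3
    then have "x = 10 \<or> 12 \<le> x"
      using reg par \<open>0 < x\<close> by presburger
    with 3 dominates_same_row[of 12 x 4 9 2] show ?thesis by auto
  next
    case 4
    with reg have "12 < x" by linarith
    moreover have "9 * (y - 2) \<le> 4 * (x - 12)"
      using reg 4 by (simp add: algebra_simps)
    ultimately have "dominates 9 4 (12, 2) (x, y)"
      using 4 by (simp add: dominates_def)
    then show ?thesis by simp
  qed
qed (rule assms, code_simp+)

lemma pcount_spectrum_6:
  assumes "a \<in> tot_pos 6"
  shows "pcount 6 a \<in> set [1, 2, 3, 4, 5, 6, 7] \<or> 12 \<le> pcount 6 a"
\<comment> \<open>The unit is 5 + 2 sqrt 6, with slope 5 / 2.\<close>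
proof (rule pcount_spectrum[where u = 10 and v = 4 and s = 2 and k = 5 and m = 2 and
    small = "[(2, 0), (4, 0), (6, 0), (6, 2), (8, 0), (8, 2), (10, 0), (10, 2), (12, 2), (12, 4), (14, 4), (18, 6)]" and
    big = "[(12, 0), (14, 2), (16, 4), (20, 6), (24, 8)]"])
  fix x y :: int assume xy: "(x, y) \<in> tot_pos 6" "0 \<le> y" "6 * 4 * y \<le> (10 - 2) * x"
  from tot_pos_coords_even[OF xy(1)] have par: "even x \<and> even y" by simp
  have reg: "24 * y \<le> 8 * x" using xy(3) by simp
  have "0 < x" using xy(1) by (simp add: tot_pos_def)
  consider "y = 0" | "y = 2" | "y = 4" | "y = 6" | "y = 8" | "10 \<le> y"
    using xy(2) par by atomize_elim presburger
  then show "(x, y) \<in> set [(2, 0), (4, 0), (6, 0), (6, 2), (8, 0), (8, 2), (10, 0), (10, 2), (12, 2), (12, 4), (14, 4), (18, 6)] \<or>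
      (\<exists>b\<in>set [(12, 0), (14, 2), (16, 4), (20, 6), (24, 8)]. dominates 5 2 b (x, y))"
  proof cases
    case 1
    then have "x = 2 \<or> x = 4 \<or> x = 6 \<or> x = 8 \<or> x = 10 \<or> 12 \<le> x"
      using reg par \<open>0 < x\<close> by presburger
    with 1 dominates_same_row[of 12 x 2 5 0] show ?thesis by auto
  next
    case 2
    then have "x = 6 \<or> x = 8 \<or> x = 10 \<or> x = 12 \<or> 14 \<le> x"
      using reg par \<open>0 < x\<close> by presburger
    with 2 dominates_same_row[of 14 x 2 5 2] show ?thesis by auto
  next
    case 3
    then have "x = 12 \<or> x = 14 \<or> 16 \<le> x"
      using reg par \<open>0 < x\<close> by presburger
    with 3 dominates_same_row[of 16 x 2 5 4] show ?thesis by auto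
  next
    case 4
    then have "x = 18 \<or> 20 \<le> x"
      using reg par \<open>0 < x\<close> by presburger
    with 4 dominates_same_row[of 20 x 2 5 6] show ?thesis by auto
  next
    case 5
    then have "24 \<le> x"
      using reg par \<open>0 < x\<close> by presburger
    with 5 dominates_same_row[of 24 x 2 5 8] show ?thesis by auto
  next
    case 6
    with reg have "24 < x" by linarith
    moreover have "5 * (y - 8) \<le> 2 * (x - 24)"
      using reg 6 by (simp add: algebra_simps)
    ultimately have "dominates 5 2 (24, 8) (x, y)"
      using 6 by (simp add: dominates_def)
    then show ?thesis by simp
  qed
qed (rule assms, code_simp+)

lemma pcount_spectrum_7:
  assumes "a \<in> tot_pos 7"
  shows "pcount 7 a \<in> set [1, 2, 3, 4, 5, 7, 8, 9] \<or> 12 \<le> pcount 7 a"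
\<comment> \<open>The unit is 8 + 3 sqrt 7, with slope 8 / 3.\<close>
proof (rule pcount_spectrum[where u = 16 and v = 6 and s = 2 and k = 8 and m = 3 and
    small = "[(2, 0), (4, 0), (6, 0), (6, 2), (8, 0), (8, 2), (10, 0), (10, 2), (12, 2), (12, 4), (14, 4), (16, 4), (18, 6), (20, 6), (24, 8)]" and
    big = "[(12, 0), (14, 2), (18, 4), (22, 6), (26, 8), (30, 10)]"])
  fix x y :: int assume xy: "(x, y) \<in> tot_pos 7" "0 \<le> y" "7 * 6 * y \<le> (16 - 2) * x"
  from tot_pos_coords_even[OF xy(1)] have par: "even x \<and> even y" by simp
  have reg: "42 * y \<le> 14 * x" using xy(3) by simp
  have "0 < x" using xy(1) by (simp add: tot_pos_def)
  consider "y = 0" | "y = 2" | "y = 4" | "y = 6" | "y = 8" | "y = 10" | "12 \<le> y"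
    using xy(2) par by atomize_elim presburger
  then show "(x, y) \<in> set [(2, 0), (4, 0), (6, 0), (6, 2), (8, 0), (8, 2), (10, 0), (10, 2), (12, 2), (12, 4), (14, 4), (16, 4), (18, 6), (20, 6), (24, 8)] \<or>
      (\<exists>b\<in>set [(12, 0), (14, 2), (18, 4), (22, 6), (26, 8), (30, 10)]. dominates 8 3 b (x, y))"
  proof cases
    case 1
    then have "x = 2 \<or> x = 4 \<or> x = 6 \<or> x = 8 \<or> x = 10 \<or> 12 \<le> x"
      using reg par \<open>0 < x\<close> by presburger
    with 1 dominates_same_row[of 12 x 3 8 0] show ?thesis by auto
  next
    case 2
    then have "x = 6 \<or> x = 8 \<or> x = 10 \<or> x = 12 \<or> 14 \<le> x"
      using reg par \<open>0 < x\<close> by presburger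
    with 2 dominates_same_row[of 14 x 3 8 2] show ?thesis by auto
  next
    case 3
    then have "x = 12 \<or> x = 14 \<or> x = 16 \<or> 18 \<le> x"
      using reg par \<open>0 < x\<close> by presburger
    with 3 dominates_same_row[of 18 x 3 8 4] show ?thesis by auto
  next
    case 4
    then have "x = 18 \<or> x = 20 \<or> 22 \<le> x"
      using reg par \<open>0 < x\<close> by presburger
    with 4 dominates_same_row[of 22 x 3 8 6] show ?thesis by auto
  next
    case 5
    then have "x = 24 \<or> 26 \<le> x"
      using reg par \<open>0 < x\<close> by presburger
    with 5 dominates_same_row[of 26 x 3 8 8] show ?thesis by auto
  next
    case 6
    then have "30 \<le> x"
      using reg par \<open>0 < x\<close> by presburger
    with 6 dominates_same_row[of 30 x 3 8 10] show ?thesis by auto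
  next
    case 7
    with reg have "30 < x" by linarith
    moreover have "8 * (y - 10) \<le> 3 * (x - 30)"
      using reg 7 by (simp add: algebra_simps)
    ultimately have "dominates 8 3 (30, 10) (x, y)"
      using 7 by (simp add: dominates_def)
    then show ?thesis by simp
  qed
qed (rule assms, code_simp+)

lemma pcount_spectrum_13:
  assumes "a \<in> tot_pos 13"
  shows "pcount 13 a \<in> set [1, 2, 3, 4, 5, 6, 7, 8] \<or> 12 \<le> pcount 13 a"
\<comment> \<open>The unit (11 + 3 sqrt 13) / 2 is the square of (3 + sqrt 13) / 2, which has norm
  -1; the slope is 11 / 3.\<close>
proof (rule pcount_spectrum[where u = 11 and v = 3 and s = 3 and k = 11 and m = 3 and
    small = "[(2, 0), (4, 0), (5, 1), (6, 0), (7, 1), (8, 0), (9, 1), (10, 0), (10, 2), (11, 1), (12, 2), (13, 3), (15, 3), (18, 4)]" and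
    big = "[(12, 0), (13, 1), (14, 2), (17, 3), (20, 4), (23, 5), (26, 6)]"])
  fix x y :: int assume xy: "(x, y) \<in> tot_pos 13" "0 \<le> y" "13 * 3 * y \<le> (11 - 2) * x"
  from tot_pos_coords_congruent[OF xy(1)] have par: "even (x - y)" by simp
  have reg: "39 * y \<le> 9 * x" using xy(3) by simp
  have "0 < x" using xy(1) by (simp add: tot_pos_def)
  consider "y = 0" | "y = 1" | "y = 2" | "y = 3" | "y = 4" | "y = 5" | "y = 6" | "7 \<le> y"
    using xy(2) par by atomize_elim presburger
  then show "(x, y) \<in> set [(2, 0), (4, 0), (5, 1), (6, 0), (7, 1), (8, 0), (9, 1), (10, 0), (10, 2), (11, 1), (12, 2), (13, 3), (15, 3), (18, 4)] \<or>
      (\<exists>b\<in>set [(12, 0), (13, 1), (14, 2), (17, 3), (20, 4), (23, 5), (26, 6)]. dominates 11 3 b (x, y))"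
  proof cases
    case 1
    then have "x = 2 \<or> x = 4 \<or> x = 6 \<or> x = 8 \<or> x = 10 \<or> 12 \<le> x"
      using reg par \<open>0 < x\<close> by presburger
    with 1 dominates_same_row[of 12 x 3 11 0] show ?thesis by auto
  next
    case 2
    then have "x = 5 \<or> x = 7 \<or> x = 9 \<or> x = 11 \<or> 13 \<le> x"
      using reg par \<open>0 < x\<close> by presburger
    with 2 dominates_same_row[of 13 x 3 11 1] show ?thesis by auto
  next
    case 3
    then have "x = 10 \<or> x = 12 \<or> 14 \<le> x"
      using reg par \<open>0 < x\<close> by presburger
    with 3 dominates_same_row[of 14 x 3 11 2] show ?thesis by auto
  next
    case 4
    then have "x = 13 \<or> x = 15 \<or> 17 \<le> x"
      using reg par \<open>0 < x\<close> by presburger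
    with 4 dominates_same_row[of 17 x 3 11 3] show ?thesis by auto
  next
    case 5
    then have "x = 18 \<or> 20 \<le> x"
      using reg par \<open>0 < x\<close> by presburger
    with 5 dominates_same_row[of 20 x 3 11 4] show ?thesis by auto
  next
    case 6
    then have "23 \<le> x"
      using reg par \<open>0 < x\<close> by presburger
    with 6 dominates_same_row[of 23 x 3 11 5] show ?thesis by auto
  next
    case 7
    then have "26 \<le> x"
      using reg par \<open>0 < x\<close> by presburger
    with 7 dominates_same_row[of 26 x 3 11 6] show ?thesis by auto
  next
    case 8
    with reg have "26 < x" by linarith
    moreover have "11 * (y - 6) \<le> 3 * (x - 26)"
      using reg 8 by (simp add: algebra_simps)
    ultimately have "dominates 11 3 (26, 6) (x, y)"
      using 8 by (simp add: dominates_def)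
    then show ?thesis by simp
  qed
qed (rule assms, code_simp+)

lemma pcount_spectrum_21:
  assumes "a \<in> tot_pos 21"
  shows "pcount 21 a \<in> set [1, 2, 3, 4, 5, 7, 8, 9] \<or> 12 \<le> pcount 21 a"
\<comment> \<open>The unit is (5 + sqrt 21) / 2, with slope 5.\<close>
proof (rule pcount_spectrum[where u = 5 and v = 1 and s = 4 and k = 5 and m = 1 and
    small = "[(2, 0), (4, 0), (6, 0), (7, 1), (8, 0), (9, 1), (10, 0), (11, 1), (14, 2)]" and
    big = "[(12, 0), (13, 1), (16, 2)]"])
  fix x y :: int assume xy: "(x, y) \<in> tot_pos 21" "0 \<le> y" "21 * 1 * y \<le> (5 - 2) * x"
  from tot_pos_coords_congruent[OF xy(1)] have par: "even (x - y)" by simp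
  have reg: "21 * y \<le> 3 * x" using xy(3) by simp
  have "0 < x" using xy(1) by (simp add: tot_pos_def)
  consider "y = 0" | "y = 1" | "y = 2" | "3 \<le> y"
    using xy(2) par by atomize_elim presburger
  then show "(x, y) \<in> set [(2, 0), (4, 0), (6, 0), (7, 1), (8, 0), (9, 1), (10, 0), (11, 1), (14, 2)] \<or>
      (\<exists>b\<in>set [(12, 0), (13, 1), (16, 2)]. dominates 5 1 b (x, y))"
  proof cases
    case 1
    then have "x = 2 \<or> x = 4 \<or> x = 6 \<or> x = 8 \<or> x = 10 \<or> 12 \<le> x"
      using reg par \<open>0 < x\<close> by presburger
    with 1 dominates_same_row[of 12 x 1 5 0] show ?thesis by auto
  next
    case 2
    then have "x = 7 \<or> x = 9 \<or> x = 11 \<or> 13 \<le> x"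
      using reg par \<open>0 < x\<close> by presburger
    with 2 dominates_same_row[of 13 x 1 5 1] show ?thesis by auto
  next
    case 3
    then have "x = 14 \<or> 16 \<le> x"
      using reg par \<open>0 < x\<close> by presburger
    with 3 dominates_same_row[of 16 x 1 5 2] show ?thesis by auto
  next
    case 4
    with reg have "16 < x" by linarith
    moreover have "5 * (y - 2) \<le> 1 * (x - 16)"
      using reg 4 by (simp add: algebra_simps)
    ultimately have "dominates 5 1 (16, 2) (x, y)"
      using 4 by (simp add: dominates_def)
    then show ?thesis by simp
  qed
qed (rule assms, code_simp+)

subsection \<open>The missing discriminants\<close>

text \<open>\<open>(2 * e, 0)\<close> is the rational integer \<open>e\<close>. If a part has
  nonzero second coordinate, so has its complement, and two traces above \<open>e\<close> cannot add
  up to \<open>2 * e\<close>. Only the parts 1 to \<open>e\<close> remain.\<close>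

lemma pcount_rational_integer:
  assumes D: "0 \<le> D" and e: "\<And>x y. (x, y) \<in> tot_pos D \<Longrightarrow> y \<noteq> 0 \<Longrightarrow> e < x"
  shows "pcount D (2 * e, 0) = count_parts D (map (\<lambda>k. (2 * k, 0)) [1..e]) (2 * e) 0"
proof (rule pcount_eq_count_parts[OF D])
  show "distinct (map (\<lambda>k. (2 * k, 0 :: int)) [1..e])"
    by (simp add: distinct_map inj_on_def)
  show "set (map (\<lambda>k. (2 * k, 0)) [1..e]) \<subseteq> tot_pos D"
    by (auto simp: tot_pos_def)
  fix u v assume uv: "(u, v) \<in> tot_pos D" "(2 * e - u, 0 - v) \<in> tot_pos D \<or> (2 * e = u \<and> 0 = v)"
  have "v = 0"
    using e[OF uv(1)] e[of "2 * e - u" "- v"] uv(2) by fastforce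
  moreover have "0 < u" "u \<le> 2 * e" using uv by (auto simp: tot_pos_def)
  moreover have "even (u * u)"
    using uv(1) \<open>v = 0\<close> dvd_trans[of 2 "4 :: int"] by (simp add: tot_pos_def del: even_mult_iff)
  then obtain k where "u = 2 * k" by (auto elim: evenE)
  ultimately show "(u, v) \<in> set (map (\<lambda>k. (2 * k, 0)) [1..e])"
    by auto
qed

lemma squarefree_not_dvd:
  fixes D :: int
  assumes "squarefree D"
  shows "\<not> 4 dvd D" "\<not> 9 dvd D"
  using squarefreeD[OF assms, of 2] squarefreeD[OF assms, of 3] by auto

text \<open>Since D <= D z^2 < x^2 <= 36, the range up to 35 is exhaustive for traces up to 6. The
  divisibility disjuncts set aside multiples of 4 and 9, which are not squarefree.\<close>

lemma small_trace_table:
  "list_all (\<lambda>D. list_all (\<lambda>x. list_all (\<lambda>z.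
     if D * z * z < x * x then
       if (x * x - D * z * z) mod 4 = 0 then
         D mod 4 = 0 \<or> D mod 9 = 0 \<or> (x = 3 \<and> D = 5) \<or> (x = 4 \<and> D \<in> set [2, 3]) \<or>
         (x = 5 \<and> D \<in> set [5, 13, 17, 21]) \<or> (x = 6 \<and> D \<in> set [2, 3, 5, 6, 7])
       else True
     else True) [1..x - 1]) [1..6]) [2..35 :: int]"
  by code_simp

lemma tot_pos_small_trace:
  assumes D: "2 \<le> D" "squarefree D" and xy: "(x, y) \<in> tot_pos D" "y \<noteq> 0" "x \<le> 6"
  shows "(x = 3 \<and> D = 5) \<or> (x = 4 \<and> D \<in> {2, 3}) \<or> (x = 5 \<and> D \<in> {5, 13, 17, 21}) \<or>
    (x = 6 \<and> D \<in> {2, 3, 5, 6, 7})"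
proof -
  define z where "z = \<bar>y\<bar>"
  have eq: "D * y * y = D * z * z" by (simp add: z_def abs_if)
  have *: "D * z * z < x * x" "(x * x - D * z * z) mod 4 = 0"
    using xy(1) by (simp_all add: tot_pos_def mod_eq_0_iff_dvd eq)
  have x: "0 < x" using xy(1) by (simp add: tot_pos_def)
  have z: "0 < z" "z < x"
    using xy(2) tot_pos_snd_le[of D x y] xy(1) D(1) by (simp_all add: z_def)
  have "1 * 1 \<le> z * z" using z by (intro mult_mono) auto
  then have "D * 1 \<le> D * (z * z)" using D(1) by (intro mult_left_mono) auto
  moreover have "x * x \<le> 6 * 6" using x xy(3) by (intro mult_mono) auto
  ultimately have "D < 36" using *(1) by (simp add: mult.assoc)
  then have mem: "D \<in> set [2..35]" "x \<in> set [1..6]" "z \<in> set [1..x - 1]"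
    unfolding set_upto atLeastAtMost_iff using D(1) x xy(3) z by auto
  have "D mod 4 \<noteq> 0" "D mod 9 \<noteq> 0"
    using squarefree_not_dvd[OF D(2)] by presburger+
  with small_trace_table[unfolded list_all_iff, THEN bspec, OF mem(1), THEN bspec, OF mem(2),
      THEN bspec, OF mem(3)] *
  show ?thesis by (simp only: if_True) simp
qed

lemma exists_pcount_rational:
  assumes D: "2 \<le> D" "squarefree D" and "1 \<le> e"
    and "\<And>x y. (x, y) \<in> tot_pos D \<Longrightarrow> y \<noteq> 0 \<Longrightarrow> e < x"
    and "count_parts D (map (\<lambda>k. (2 * k, 0)) [1..e]) (2 * e) 0 = m"
  shows "D \<notin> missing_discs m"
proof -
  have "(2 * e, 0) \<in> tot_pos D" using assms(3) by (simp add: tot_pos_def)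
  then show ?thesis
    using pcount_rational_integer[of D e] assms unfolding missing_discs_iff by auto
qed

lemma not_missing_discsI:
  assumes "0 < s" "s * s \<le> D" "0 < x" "D * y * y < x * x" "(x * x - D * y * y) mod 4 = 0"
    "count_parts D (parts_list s D x y) x y = m"
  shows "D \<notin> missing_discs m"
proof -
  have "(x, y) \<in> tot_pos D" using assms by (simp add: tot_pos_def mod_eq_0_iff_dvd)
  then show ?thesis
    using pcount_code[of s D x y] assms unfolding missing_discs_iff by auto
qed

text \<open>Here irrational elements of small trace spoil the count for the rational integers 5 and
  6, so other witnesses are given: 5 + sqrt 3 and (11 + sqrt D) / 2 have 7 partitions, 14 + 3 sqrt
  17 has 11.\<close>

lemma not_missing_exceptional:
  "3 \<notin> missing_discs 7" "13 \<notin> missing_discs 7" "17 \<notin> missing_discs 7" "21 \<notin> missing_discs 7"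
  "17 \<notin> missing_discs 11"
proof -
  show "3 \<notin> missing_discs 7"
    by (rule not_missing_discsI[where s = 1 and x = 10 and y = 2]) code_simp+
  show "13 \<notin> missing_discs 7"
    by (rule not_missing_discsI[where s = 3 and x = 11 and y = 1]) code_simp+
  show "17 \<notin> missing_discs 7"
    by (rule not_missing_discsI[where s = 4 and x = 11 and y = 1]) code_simp+
  show "21 \<notin> missing_discs 7"
    by (rule not_missing_discsI[where s = 4 and x = 11 and y = 1]) code_simp+
  show "17 \<notin> missing_discs 11"
    by (rule not_missing_discsI[where s = 4 and x = 28 and y = 6]) code_simp+
qed

text \<open>The root of a square divisor below 25 is at most 4 in absolute value, and 16 is covered
  by 4. The bound suffices for the exceptional fields, which end at D = 21.\<close>

lemma squarefree_if_less_25: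
  fixes n :: int
  assumes "0 < n" "n < 25" "\<not> 4 dvd n" "\<not> 9 dvd n"
  shows "squarefree n"
  unfolding squarefree_def
proof (intro allI impI)
  fix x assume x: "x\<^sup>2 dvd n"
  then have "\<bar>x\<bar>\<^sup>2 < 5\<^sup>2"
    using zdvd_imp_le[OF x assms(1)] assms(2) by simp
  then have "\<bar>x\<bar> < 5"
    by (rule power_less_imp_less_base) simp
  have xx: "\<bar>x\<bar> * \<bar>x\<bar> dvd n"
    using x by (simp add: power2_eq_square)
  have "\<bar>x\<bar> \<noteq> c" if "\<not> c * c dvd n" for c
    using xx that by metis
  from this[of 0] this[of 2] this[of 3] this[of 4]
  have "\<bar>x\<bar> \<noteq> 0" "\<bar>x\<bar> \<noteq> 2" "\<bar>x\<bar> \<noteq> 3" "\<bar>x\<bar> \<noteq> 4"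
    using assms dvd_trans[of 4 16 n] by auto
  with \<open>\<bar>x\<bar> < 5\<close> have "\<bar>x\<bar> = 1" by linarith
  then show "is_unit x" by simp
qed

text \<open>The second coordinate stays 0, so the cone test does not depend on \<open>D\<close>, and
  the values are the ordinary partition numbers.\<close>

lemma count_rational:
  "count_parts D (map (\<lambda>k. (2 * k, 0)) [1..1]) (2 * 1) 0 = 1"
  "count_parts D (map (\<lambda>k. (2 * k, 0)) [1..2]) (2 * 2) 0 = 2"
  "count_parts D (map (\<lambda>k. (2 * k, 0)) [1..3]) (2 * 3) 0 = 3"
  "count_parts D (map (\<lambda>k. (2 * k, 0)) [1..4]) (2 * 4) 0 = 5"
  "count_parts D (map (\<lambda>k. (2 * k, 0)) [1..5]) (2 * 5) 0 = 7"
  "count_parts D (map (\<lambda>k. (2 * k, 0)) [1..6]) (2 * 6) 0 = 11"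
  by (simp_all add: count_parts.simps upto.simps)

context
  fixes D :: int
  assumes D: "2 \<le> D" "squarefree D"
begin

lemma not_missing_rational:
  "D \<notin> missing_discs 1" "D \<notin> missing_discs 2"
  "D \<noteq> 5 \<Longrightarrow> D \<notin> missing_discs 3"
  "D \<notin> {2, 3, 5} \<Longrightarrow> D \<notin> missing_discs 5"
  "D \<notin> {2, 3, 5, 13, 17, 21} \<Longrightarrow> D \<notin> missing_discs 7"
  "D \<notin> {2, 3, 5, 6, 7, 13, 17, 21} \<Longrightarrow> D \<notin> missing_discs 11"
proof -
  \<comment> \<open>The least traces of irrational elements, where at most 6, are 3 for D = 5; 4 for
    D = 2, 3; 5 for D = 13, 17, 21; 6 for D = 6, 7. The number \<open>e\<close> has to stay below
    them.\<close>
  have trace: "e < x"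
    if "e \<le> 6" "e < 3 \<or> D \<noteq> 5" "e < 4 \<or> D \<notin> {2, 3}"
      "e < 5 \<or> D \<notin> {13, 17, 21}" "e < 6 \<or> D \<notin> {6, 7}" "(x, y) \<in> tot_pos D" "y \<noteq> 0" for e x y
    using tot_pos_small_trace[OF D that(6,7)] that(1-5) by (cases "x \<le> 6") auto
  show "D \<notin> missing_discs 1"
    by (rule exists_pcount_rational[OF D _ trace count_rational(1)]) simp_all
  show "D \<notin> missing_discs 2"
    by (rule exists_pcount_rational[OF D _ trace count_rational(2)]) simp_all
  show "D \<notin> missing_discs 3" if "D \<noteq> 5"
    by (rule exists_pcount_rational[OF D _ trace count_rational(3)]) (use that in simp_all)
  show "D \<notin> missing_discs 5" if "D \<notin> {2, 3, 5}"
    by (rule exists_pcount_rational[OF D _ trace count_rational(4)]) (use that in simp_all)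
  show "D \<notin> missing_discs 7" if "D \<notin> {2, 3, 5, 13, 17, 21}"
    by (rule exists_pcount_rational[OF D _ trace count_rational(5)]) (use that in simp_all)
  show "D \<notin> missing_discs 11" if "D \<notin> {2, 3, 5, 6, 7, 13, 17, 21}"
    by (rule exists_pcount_rational[OF D _ trace count_rational(6)]) (use that in simp_all)
qed

end

lemma missing_discsI:
  assumes "2 \<le> D" "D < 25" "\<not> 4 dvd D" "\<not> 9 dvd D"
    and "\<And>a. a \<in> tot_pos D \<Longrightarrow> pcount D a \<in> set vals \<or> N \<le> pcount D a"
    and "m \<notin> set vals" "m < N"
  shows "D \<in> missing_discs m"
  unfolding missing_discs_iff
proof (intro conjI ballI)
  show "squarefree D" using assms(1-4) by (intro squarefree_if_less_25) auto
  show "pcount D a \<noteq> m" if "a \<in> tot_pos D" for a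
    using assms(5)[OF that] assms(6,7) by auto
qed (rule assms(1))

lemma missing_discs_members:
  "5 \<in> missing_discs 3"
  "2 \<in> missing_discs 5" "3 \<in> missing_discs 5" "5 \<in> missing_discs 5"
  "2 \<in> missing_discs 7" "5 \<in> missing_discs 7"
  "{2, 3, 5, 6, 7, 13, 21} \<subseteq> missing_discs 11"
proof -
  show "5 \<in> missing_discs 3" "5 \<in> missing_discs 5" "5 \<in> missing_discs 7"
    by (rule missing_discsI[OF _ _ _ _ pcount_spectrum_5]; simp)+
  show "2 \<in> missing_discs 5" "2 \<in> missing_discs 7"
    by (rule missing_discsI[OF _ _ _ _ pcount_spectrum_2]; simp)+
  show "3 \<in> missing_discs 5"
    by (rule missing_discsI[OF _ _ _ _ pcount_spectrum_3]; simp)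
  show "{2, 3, 5, 6, 7, 13, 21} \<subseteq> missing_discs 11"
    by (intro insert_subsetI empty_subsetI
          missing_discsI[OF _ _ _ _ pcount_spectrum_2] missing_discsI[OF _ _ _ _ pcount_spectrum_3]
          missing_discsI[OF _ _ _ _ pcount_spectrum_5] missing_discsI[OF _ _ _ _ pcount_spectrum_6]
          missing_discsI[OF _ _ _ _ pcount_spectrum_7] missing_discsI[OF _ _ _ _ pcount_spectrum_13]
          missing_discsI[OF _ _ _ _ pcount_spectrum_21]; simp)
qed

theorem theorem1p3:
  shows "missing_discs 1 = {} \<and>
         missing_discs 2 = {} \<and>
         missing_discs 3 = {5} \<and>
         missing_discs 5 = {2, 3, 5} \<and>
         missing_discs 7 = {2, 5} \<and>
         missing_discs 11 = {2, 3, 5, 6, 7, 13, 21}"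
proof -
  have D: "2 \<le> D" "squarefree D" if "D \<in> missing_discs m" for D m
    using that by (auto simp: missing_discs_iff)
  have "missing_discs 1 = {}" "missing_discs 2 = {}"
    using not_missing_rational(1,2)[OF D] by blast+
  moreover have "missing_discs 3 = {5}"
    using not_missing_rational(3)[OF D] missing_discs_members(1) by blast
  moreover have "missing_discs 5 = {2, 3, 5}"
  proof (intro equalityI subsetI)
    show "D \<in> {2, 3, 5}" if "D \<in> missing_discs 5" for D
      using not_missing_rational(4)[OF D[OF that]] that by blast
  qed (use missing_discs_members(2-4) in blast)
  moreover have "missing_discs 7 = {2, 5}"
  proof (intro equalityI subsetI)
    \<comment> \<open>The rational integer 5 leaves the candidates 2, 3, 5, 13, 17, 21, and explicit
      witnesses remove 3, 13, 17, 21.\<close>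
    show "D \<in> {2, 5}" if "D \<in> missing_discs 7" for D
      using not_missing_rational(5)[OF D[OF that]] not_missing_exceptional(1-4) that by blast
  qed (use missing_discs_members(5,6) in blast)
  moreover have "missing_discs 11 = {2, 3, 5, 6, 7, 13, 21}"
  proof (intro equalityI subsetI)
    \<comment> \<open>The rational integer 6 leaves one further candidate, 17, which has its own
      witness.\<close>
    show "D \<in> {2, 3, 5, 6, 7, 13, 21}" if "D \<in> missing_discs 11" for D
      using not_missing_rational(6)[OF D[OF that]] not_missing_exceptional(5) that by blast
  qed (use missing_discs_members(7) in blast)
  ultimately show ?thesis by blast
qed

end
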